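(* Let $p>q$ be positive integers, let $\alpha=\log_2(2p/q)$, and let $$\tilde B_{pq}^+=\langle a,b,s,t,\theta,z\mid z\text{ central},\ [b,\theta]=z,\ [a,b]=1,\ s^{-1}a^qs=a^pb,\ t^{-1}a^qt=a^pb^{-1}\rangle.$$ Then $\mathrm{CL}_{\tilde B_{pq}^+}(n)\simeq n^{\alpha+1}$.
   Context: $[x,y]=x^{-1}y^{-1}xy$; "$z$ central" abbreviates the relations saying that $z$ commutes with each of the other generators. For a group $G$ with a fixed finite generating set, and words $u,v$ in the generators and their inverses, $|u|$ is word length and $u\sim v$ means that $u$ and $v$ represent conjugate elements of $G$. If $u\sim v$, $\mathrm{CL}(u,v)$ is the length of a shortest word $w$ with $uw=wv$ in $G$. The conjugator length function is $\mathrm{CL}_G(n)=\max\{\mathrm{CL}(u,v)\mid |u|+|v|\le n,\ u\sim v\}$; up to $\simeq$ it is independent of the finite generating set. For functions $f,g:\mathbb{N}\to[0,\infty)$, $f\lesssim g$ means there is a positive integer constant $C$ with $f(n)\le C\,g(Cn+n)+Cn+C$ for all $n$; $f\simeq g$ means $f\lesssim g$ and $g\lesssim f$. *)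

theory Defs
  imports Complex_Main "HOL-Algebra.Group"
begin

text \<open>
  Words in the letters \<open>x\<close> and \<open>x\<^sup>-\<^sup>1\<close> for \<open>x :: 'g\<close>: the pair \<open>(x, True)\<close> is the letter \<open>x\<close>
  and \<open>(x, False)\<close> its formal inverse. Words need not be reduced.
\<close>

type_synonym 'g gword = "('g \<times> bool) list"

definition gen :: "'g \<Rightarrow> 'g gword" where
  "gen x = [(x, True)]"

definition winv :: "'g gword \<Rightarrow> 'g gword" where
  "winv w = rev (map (\<lambda>(x, e). (x, \<not> e)) w)"

definition wpow :: "'g gword \<Rightarrow> nat \<Rightarrow> 'g gword" where
  "wpow w n = concat (replicate n w)"

definition wcomm :: "'g gword \<Rightarrow> 'g gword \<Rightarrow> 'g gword" where
  "wcomm x y = winv x @ winv y @ x @ y"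

inductive pres_eq :: "('g gword \<times> 'g gword) set \<Rightarrow> 'g gword \<Rightarrow> 'g gword \<Rightarrow> bool"
  for R :: "('g gword \<times> 'g gword) set"
where
  pres_refl: "pres_eq R u u"
| pres_sym: "pres_eq R u v \<Longrightarrow> pres_eq R v u"
| pres_trans: "pres_eq R u v \<Longrightarrow> pres_eq R v w \<Longrightarrow> pres_eq R u w"
| pres_app: "pres_eq R u u' \<Longrightarrow> pres_eq R v v' \<Longrightarrow> pres_eq R (u @ v) (u' @ v')"
| pres_cancel: "pres_eq R [(x, e), (x, \<not> e)] []"
| pres_rel: "(u, v) \<in> R \<Longrightarrow> pres_eq R u v"

definition pres_class :: "('g gword \<times> 'g gword) set \<Rightarrow> 'g gword \<Rightarrow> 'g gword set" where
  "pres_class R u = {v. pres_eq R u v}"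

text \<open>The group presented by the generators \<open>UNIV :: 'g set\<close> and the relations \<open>u = v\<close>, \<open>(u, v) \<in> R\<close>.\<close>

definition presented_group :: "('g gword \<times> 'g gword) set \<Rightarrow> 'g gword set monoid" where
  "presented_group R =
     \<lparr> carrier = range (pres_class R),
       mult = (\<lambda>A B. {w. \<exists>u\<in>A. \<exists>v\<in>B. pres_eq R (u @ v) w}),
       one = pres_class R [] \<rparr>"

lemma pres_class_eq_iff: "pres_class R u = pres_class R v \<longleftrightarrow> pres_eq R u v"
  unfolding pres_class_def by (blast intro: pres_refl pres_sym pres_trans)

lemma carrier_presented_group: "carrier (presented_group R) = range (pres_class R)"
  by (simp add: presented_group_def)

lemma one_presented_group: "\<one>\<^bsub>presented_group R\<^esub> = pres_class R []"
  by (simp add: presented_group_def)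

lemma mult_presented_group:
  "pres_class R u \<otimes>\<^bsub>presented_group R\<^esub> pres_class R v = pres_class R (u @ v)"
  unfolding presented_group_def pres_class_def
  by (auto intro: pres_refl pres_sym pres_trans pres_app)

lemma winv_simps: "winv [] = []" "winv ((x, e) # w) = winv w @ [(x, \<not> e)]"
  by (simp_all add: winv_def)

lemma pres_eq_winv_left: "pres_eq R (winv w @ w) []"
proof (induction w)
  case Nil
  show ?case by (simp add: winv_simps pres_refl)
next
  case (Cons l w)
  obtain x e where l: "l = (x, e)" by (cases l)
  have "pres_eq R ([(x, \<not> e), (x, \<not> \<not> e)] @ w) ([] @ w)"
    by (intro pres_app pres_cancel pres_refl)
  then have "pres_eq R (winv w @ [(x, \<not> e), (x, e)] @ w) (winv w @ w)"
    by (intro pres_app pres_refl) simp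
  then show ?case using Cons.IH by (auto simp: l winv_simps intro: pres_trans)
qed

lemma group_presented_group: "group (presented_group R)"
proof (rule groupI)
  fix x assume "x \<in> carrier (presented_group R)"
  then obtain u where "x = pres_class R u" by (auto simp: carrier_presented_group)
  then have "pres_class R (winv u) \<otimes>\<^bsub>presented_group R\<^esub> x = \<one>\<^bsub>presented_group R\<^esub>"
    by (simp add: mult_presented_group one_presented_group pres_class_eq_iff pres_eq_winv_left)
  then show "\<exists>y\<in>carrier (presented_group R). y \<otimes>\<^bsub>presented_group R\<^esub> x = \<one>\<^bsub>presented_group R\<^esub>"
    by (auto simp: carrier_presented_group)
qed (auto simp: carrier_presented_group mult_presented_group one_presented_group)

lemma inv_presented_group: "inv\<^bsub>presented_group R\<^esub> (pres_class R u) = pres_class R (winv u)"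
  by (rule group.inv_equality[OF group_presented_group])
     (auto simp: mult_presented_group one_presented_group pres_class_eq_iff
        pres_eq_winv_left carrier_presented_group)

text \<open>
  In the following definitions \<open>\<iota>\<close> names the elements of a finite generating family of \<open>G\<close>,
  indexed by a finite type.
\<close>

definition word_val :: "('a, 'm) monoid_scheme \<Rightarrow> ('g \<Rightarrow> 'a) \<Rightarrow> 'g gword \<Rightarrow> 'a" where
  "word_val G \<iota> w =
     foldr (\<lambda>(x, e) h. (if e then \<iota> x else inv\<^bsub>G\<^esub> (\<iota> x)) \<otimes>\<^bsub>G\<^esub> h) w \<one>\<^bsub>G\<^esub>"

definition conj_words ::
  "('a, 'm) monoid_scheme \<Rightarrow> ('g \<Rightarrow> 'a) \<Rightarrow> 'g gword \<Rightarrow> 'g gword \<Rightarrow> bool" where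
  "conj_words G \<iota> u v \<longleftrightarrow>
     (\<exists>g\<in>carrier G. inv\<^bsub>G\<^esub> g \<otimes>\<^bsub>G\<^esub> word_val G \<iota> u \<otimes>\<^bsub>G\<^esub> g = word_val G \<iota> v)"

definition CL_pair ::
  "('a, 'm) monoid_scheme \<Rightarrow> ('g \<Rightarrow> 'a) \<Rightarrow> 'g gword \<Rightarrow> 'g gword \<Rightarrow> nat" where
  "CL_pair G \<iota> u v =
     (LEAST k. \<exists>w. length w = k \<and>
        word_val G \<iota> u \<otimes>\<^bsub>G\<^esub> word_val G \<iota> w = word_val G \<iota> w \<otimes>\<^bsub>G\<^esub> word_val G \<iota> v)"

text \<open>
  The class constraint makes the set below finite; it is nonempty since it contains
  the value at the pair of empty words.
\<close>

definition CL :: "('a, 'm) monoid_scheme \<Rightarrow> ('g::finite \<Rightarrow> 'a) \<Rightarrow> nat \<Rightarrow> nat" where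
  "CL G \<iota> n =
     Max {CL_pair G \<iota> u v | u v. length u + length v \<le> n \<and> conj_words G \<iota> u v}"

definition pres_gen :: "('g gword \<times> 'g gword) set \<Rightarrow> 'g \<Rightarrow> 'g gword set" where
  "pres_gen R x = pres_class R (gen x)"

lemma word_val_presented_group: "word_val (presented_group R) (pres_gen R) w = pres_class R w"
proof (induction w)
  case Nil
  show ?case by (simp add: word_val_def one_presented_group)
next
  case (Cons l w)
  obtain x e where l: "l = (x, e)" by (cases l)
  have "(if e then pres_gen R x else inv\<^bsub>presented_group R\<^esub> (pres_gen R x)) = pres_class R [l]"
    by (simp add: l pres_gen_def gen_def inv_presented_group winv_def)
  then show ?case using Cons.IH
    by (simp add: word_val_def l mult_presented_group)
qed

definition growth_le :: "(nat \<Rightarrow> real) \<Rightarrow> (nat \<Rightarrow> real) \<Rightarrow> bool" (infix \<open>\<lesssim>\<close> 50) where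
  "f \<lesssim> g \<longleftrightarrow>
     (\<exists>C::nat. C > 0 \<and> (\<forall>n. f n \<le> real C * g (C * n + n) + real C * real n + real C))"

definition growth_equiv :: "(nat \<Rightarrow> real) \<Rightarrow> (nat \<Rightarrow> real) \<Rightarrow> bool" (infix \<open>\<simeq>\<close> 50) where
  "f \<simeq> g \<longleftrightarrow> f \<lesssim> g \<and> g \<lesssim> f"

datatype B_gen = Ba | Bb | Bs | Bt | Btheta | Bz

lemma UNIV_B_gen: "UNIV = {Ba, Bb, Bs, Bt, Btheta, Bz}"
  using B_gen.exhaust by auto

instance B_gen :: finite
  by standard (simp add: UNIV_B_gen)

definition B_rels :: "nat \<Rightarrow> nat \<Rightarrow> (B_gen gword \<times> B_gen gword) set" where
  "B_rels p q =
     {(gen Bz @ gen x, gen x @ gen Bz) | x. x \<noteq> Bz} \<union>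
     {(wcomm (gen Bb) (gen Btheta), gen Bz),
      (wcomm (gen Ba) (gen Bb), []),
      (winv (gen Bs) @ wpow (gen Ba) q @ gen Bs, wpow (gen Ba) p @ gen Bb),
      (winv (gen Bt) @ wpow (gen Ba) q @ gen Bt, wpow (gen Ba) p @ winv (gen Bb))}"

abbreviation B_tilde :: "nat \<Rightarrow> nat \<Rightarrow> B_gen gword set monoid" where
  "B_tilde p q \<equiv> presented_group (B_rels p q)"

abbreviation CL_B_tilde :: "nat \<Rightarrow> nat \<Rightarrow> nat \<Rightarrow> nat" where
  "CL_B_tilde p q \<equiv> CL (B_tilde p q) (pres_gen (B_rels p q))"

end

theory Submission
  imports Defs "HOL-Library.Product_Plus"
begin

text \<open>
  Together with the central element \<open>z\<close> the generators \<open>a\<close>, \<open>b\<close> span a copy of \<open>\<int>\<^sup>3\<close>, and the group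
  is a multiple HNN extension of it: \<open>s\<close> and \<open>t\<close> carry \<open>\<langle>a\<^sup>q, z\<rangle>\<close> to \<open>\<langle>a\<^sup>p b, z\<rangle>\<close> and
  \<open>\<langle>a\<^sup>p b\<^sup>-\<^sup>1, z\<rangle>\<close>, while \<open>\<theta>\<close> acts on \<open>\<langle>b, z\<rangle>\<close> by the shear \<open>b \<mapsto> b z\<close>. Since
  \<open>(a\<^sup>p b)(a\<^sup>p b\<^sup>-\<^sup>1) = a\<^bsup>2p\<^esup>\<close>, a word for \<open>a\<^bsup>qm\<^esup>\<close> yields one for \<open>a\<^bsup>2pm\<^esup>\<close> of about twice the length,
  so words of length \<open>n\<close> reach powers of \<open>a\<close> and of \<open>b\<close> with exponent about \<open>n\<^sup>\<alpha>\<close>; and as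
  \<open>[b\<^sup>m, \<theta>\<^sup>k] = z\<^bsup>mk\<^esup>\<close> they reach powers of \<open>z\<close> with exponent about \<open>n\<^bsup>\<alpha>+1\<^esup>\<close>.

  Lower bound. The letter \<open>\<theta>\<close> itself is not distorted, and \<open>\<theta>\<^sup>N\<close> conjugates \<open>b\<close> to \<open>b z\<^sup>N\<close>. Normal
  forms show that every conjugator of this pair contains at least \<open>N\<close> stable letters
  (\<open>elliptic_conj_words\<close>, \<open>chain_related\<close>), although \<open>b z\<^sup>N\<close> has a representative of length \<open>n\<close> with
  \<open>N\<close> about \<open>n\<^bsup>\<alpha>+1\<^esup>\<close>.

  Upper bound. The exponents above are best possible (\<open>base_distortion\<close>): amplification by the
  factor \<open>p/q\<close> produces a power of \<open>a\<^sup>p b\<^bsup>\<plusminus>1\<^esup>\<close>, and getting back to a power of \<open>a\<close> or \<open>b\<close> requires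
  two balancing pieces, the shorter of which has at most half of the length. Conjugate words
  \<open>u\<close>, \<open>v\<close> have rotations that are either elements of \<open>\<int>\<^sup>3\<close> or cyclically reduced
  (\<open>conj_classification\<close>). In the first case the exponent of the conjugating power of \<open>\<theta>\<close> is at most
  a difference of two exponents of \<open>z\<close>. In the second case, up to further rotation, the
  conjugator is an element of an edge group, thus modulo \<open>z\<close> a power of one of \<open>a\<^sup>q\<close>,
  \<open>a\<^sup>p b\<close>, \<open>a\<^sup>p b\<^sup>-\<^sup>1\<close>, \<open>b\<close>. Either two edge groups of different directions meet at some vertex of the axis,
  and linear algebra bounds the exponent by \<open>O(n\<^sup>\<alpha>)\<close> (\<open>conjw_not_parallel\<close>); or the word commutes
  with that element up to a power of \<open>z\<close>, and the exponent is bounded by that of a power of \<open>z\<close> which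
  is a word of length \<open>O(n)\<close> (\<open>conjw_parallel\<close>). Hence all exponents are \<open>O(n\<^bsup>\<alpha>+1\<^esup>)\<close>.
\<close>

section \<open>The symmetric group of a type, written additively\<close>

text \<open>
  Words will act on normal forms from the right, so \<open>f + g\<close> means first \<open>f\<close>, then \<open>g\<close>. The additive
  notation makes the type an instance of \<open>group_add\<close>, whose laws are those of an arbitrary group.
\<close>
typedef 'a sym = "{f :: 'a \<Rightarrow> 'a. bij f}"
  morphisms app Sym
  by (rule exI[of _ id]) simp

setup_lifting type_definition_sym

instantiation sym :: (type) group_add
begin

lift_definition zero_sym :: "'a sym" is id by simp
lift_definition plus_sym :: "'a sym \<Rightarrow> 'a sym \<Rightarrow> 'a sym" is "\<lambda>f g. g \<circ> f"
  by (simp add: bij_comp)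
lift_definition uminus_sym :: "'a sym \<Rightarrow> 'a sym" is "inv_into UNIV"
  by (simp add: bij_imp_bij_inv)
definition minus_sym :: "'a sym \<Rightarrow> 'a sym \<Rightarrow> 'a sym" where
  "minus_sym f g = f + - g"

instance
proof
  fix a b c :: "'a sym"
  show "a + b + c = a + (b + c)" by transfer auto
  show "0 + a = a" by transfer auto
  show "a + 0 = a" by transfer auto
  show "- a + a = 0" by transfer (simp add: bij_is_surj surj_f_inv_f fun_eq_iff)
  show "a + - b = a - b" by (simp add: minus_sym_def)
qed

end

lemma app_plus: "app (f + g) x = app g (app f x)"
  by transfer simp

lemma app_zero: "app 0 x = x"
  by transfer simp

lemma sym_eqI: "(\<And>x. app f x = app g x) \<Longrightarrow> f = g"
  by transfer auto

lemma app_Sym: 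
  assumes "\<And>x. g (f x) = x" "\<And>x. f (g x) = x"
  shows "app (Sym f) = f"
  by (rule Sym_inverse) (use assms in \<open>auto intro!: bij_betw_byWitness[where f' = g]\<close>)

section \<open>Normal forms in multiple HNN extensions of an abelian group\<close>

text \<open>
  The stable letters come in inverse pairs \<open>e\<close>, \<open>ie e\<close>, and the relations are \<open>h e = e \<phi>\<^sub>e(h)\<close> for
  \<open>h\<close> in the edge group \<open>H e\<close>. The group is realised by its right action on normal forms, which makes
  the normal form theorem a matter of checking that letters act as bijections.
\<close>
locale hnn =
  fixes H :: "'e \<Rightarrow> 'm::ab_group_add set" and \<phi> :: "'e \<Rightarrow> 'm \<Rightarrow> 'm" and ie :: "'e \<Rightarrow> 'e"
  assumes ie_ie [simp]: "ie (ie e) = e"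
    and ie_neq: "ie e \<noteq> e"
    and H_zero [simp]: "0 \<in> H e"
    and H_add: "x \<in> H e \<Longrightarrow> y \<in> H e \<Longrightarrow> x + y \<in> H e"
    and H_minus: "x \<in> H e \<Longrightarrow> - x \<in> H e"
    and \<phi>_add: "x \<in> H e \<Longrightarrow> y \<in> H e \<Longrightarrow> \<phi> e (x + y) = \<phi> e x + \<phi> e y"
    and \<phi>_in: "x \<in> H e \<Longrightarrow> \<phi> e x \<in> H (ie e)"
    and \<phi>_inv: "x \<in> H e \<Longrightarrow> \<phi> (ie e) (\<phi> e x) = x"
begin

lemma H_minus_iff [simp]: "- x \<in> H e \<longleftrightarrow> x \<in> H e"
  using H_minus[of x e] H_minus[of "- x" e] by auto

lemma H_diff: "x \<in> H e \<Longrightarrow> y \<in> H e \<Longrightarrow> x - y \<in> H e"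
  using H_add[of x e "- y"] by simp

lemma H_add_iff: "x \<in> H e \<Longrightarrow> x + y \<in> H e \<longleftrightarrow> y \<in> H e"
  using H_add[of x e y] H_diff[of "x + y" e x] by auto

lemma \<phi>_zero [simp]: "\<phi> e 0 = 0"
  using \<phi>_add[of 0 e 0] by simp

text \<open>
  A transversal of the cosets of \<open>H e\<close>: the choice depends on the coset only.
\<close>
definition rep :: "'e \<Rightarrow> 'm \<Rightarrow> 'm" where
  "rep e h = (SOME r. r - h \<in> H e)"

lemma rep_in: "rep e h - h \<in> H e"
  unfolding rep_def by (rule someI[of _ h]) simp

lemma rep_in': "h - rep e h \<in> H e"
  using H_minus[OF rep_in[of e h]] by simp

lemma rep_cong: "h - h' \<in> H e \<Longrightarrow> rep e h = rep e h'"
proof -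
  assume h: "h - h' \<in> H e"
  have "(r - h \<in> H e) = (r - h' \<in> H e)" for r
    using H_add[OF _ h, of "r - h"] H_diff[OF _ h, of "r - h'"] by auto
  then show ?thesis by (simp add: rep_def)
qed

lemma rep_eq_iff: "rep e h = rep e h' \<longleftrightarrow> h - h' \<in> H e"
  using rep_cong H_add[OF rep_in'[of h e] rep_in[of e h']] by auto

lemma rep_rep [simp]: "rep e (rep e h) = rep e h"
  by (rule rep_cong) (rule rep_in)

lemma rep_in_H_iff: "rep e h \<in> H e \<longleftrightarrow> h \<in> H e"
  using H_add_iff[OF rep_in'[of h e], of "rep e h"] by simp

text \<open>
  The state \<open>(h, [(e\<^sub>k, r\<^sub>k), \<dots>, (e\<^sub>1, r\<^sub>1)])\<close> stands for the normal form
  \<open>r\<^sub>1 e\<^sub>1 \<dots> r\<^sub>k e\<^sub>k h\<close>, so that right multiplication only touches the head of the list.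
\<close>

fun valid :: "('e \<times> 'm) list \<Rightarrow> bool" where
  "valid [] \<longleftrightarrow> True"
| "valid ((e, r) # st) \<longleftrightarrow> rep e r = r \<and> valid st \<and>
     (case st of [] \<Rightarrow> True | (e', _) # _ \<Rightarrow> \<not> (e' = ie e \<and> r \<in> H e))"

definition pops :: "'e \<Rightarrow> 'm \<times> ('e \<times> 'm) list \<Rightarrow> bool" where
  "pops e s \<longleftrightarrow> fst s \<in> H e \<and> (case snd s of [] \<Rightarrow> False | (e', _) # _ \<Rightarrow> e' = ie e)"

definition push_letter :: "'e \<Rightarrow> 'm \<times> ('e \<times> 'm) list \<Rightarrow> 'm \<times> ('e \<times> 'm) list" where
  "push_letter e s = (\<phi> e (fst s - rep e (fst s)), (e, rep e (fst s)) # snd s)"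

definition pop_letter :: "'e \<Rightarrow> 'm \<times> ('e \<times> 'm) list \<Rightarrow> 'm \<times> ('e \<times> 'm) list" where
  "pop_letter e s = (snd (hd (snd s)) + \<phi> e (fst s), tl (snd s))"

text \<open>
  Right multiplication by \<open>e\<close>. Writing \<open>h = r + h'\<close> with \<open>r = rep e h\<close>, we have \<open>h e = r e \<phi>\<^sub>e(h')\<close>,
  which adds an entry, unless \<open>h\<close> lies in \<open>H e\<close> and the last letter is \<open>ie e\<close>, which then cancels.
  States that are not normal forms are fixed, so that the action is defined on the whole type.
\<close>
definition step :: "'e \<Rightarrow> 'm \<times> ('e \<times> 'm) list \<Rightarrow> 'm \<times> ('e \<times> 'm) list" where
  "step e s = (if \<not> valid (snd s) then s else if pops e s then pop_letter e s else push_letter e s)"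

lemma valid_step: "valid (snd s) \<Longrightarrow> valid (snd (step e s))"
  by (auto simp: step_def pops_def pop_letter_def push_letter_def rep_in_H_iff split: list.splits)

text \<open>
  What a letter pushes, its inverse pops. Conversely, after \<open>e\<close> has popped \<open>ie e\<close>, the letter \<open>ie e\<close>
  pushes again: it could only pop if the removed entry had not been reduced against the one below.
\<close>
lemma step_step: "step (ie e) (step e s) = s"
proof (cases "valid (snd s)")
  case v: True
  obtain h st where s: "s = (h, st)" by (cases s)
  show ?thesis
  proof (cases "pops e s")
    case True
    then obtain r st' where st: "st = (ie e, r) # st'" and h: "h \<in> H e"
      by (auto simp: s pops_def split: list.splits)
    have e: "step e s = (r + \<phi> e h, st')"
      using v True by (simp add: s st step_def pop_letter_def)
    have r: "rep (ie e) (r + \<phi> e h) = r"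
      using v rep_cong[of "r + \<phi> e h" r "ie e"] \<phi>_in[OF h] by (simp add: s st)
    have "\<not> pops (ie e) (r + \<phi> e h, st')"
      using v H_add_iff[OF \<phi>_in[OF h], of r]
      by (auto simp: s st pops_def add.commute split: list.splits)
    with v show ?thesis
      by (simp add: e) (simp add: s st step_def push_letter_def r \<phi>_inv[OF h])
  next
    case False
    have e: "step e s = (\<phi> e (h - rep e h), (e, rep e h) # st)"
      using v False by (simp add: s step_def push_letter_def)
    have v': "valid ((e, rep e h) # st)"
      using valid_step[OF v, of e] by (simp only: e snd_conv)
    have "pops (ie e) (\<phi> e (h - rep e h), (e, rep e h) # st)"
      using \<phi>_in[OF rep_in'[of h e]] by (simp add: pops_def)
    then show ?thesis
      using v' unfolding e
      by (simp add: step_def pop_letter_def \<phi>_inv[OF rep_in'] s del: valid.simps)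
  qed
qed (simp add: step_def)

definition t :: "'e \<Rightarrow> ('m \<times> ('e \<times> 'm) list) sym" where
  "t e = Sym (step e)"

definition \<mu> :: "'m \<Rightarrow> ('m \<times> ('e \<times> 'm) list) sym" where
  "\<mu> m = Sym (\<lambda>s. if valid (snd s) then (fst s + m, snd s) else s)"

lemma app_t: "app (t e) = step e"
  unfolding t_def by (rule app_Sym[of "step (ie e)"]) (use step_step[of "ie e"] step_step[of e] in auto)

lemma app_\<mu>: "app (\<mu> m) s = (if valid (snd s) then (fst s + m, snd s) else s)"
  unfolding \<mu>_def
  by (subst app_Sym[of "\<lambda>s. if valid (snd s) then (fst s - m, snd s) else s"]) auto

lemma t_ie: "t (ie e) = - t e"
proof -
  have "t e + t (ie e) = 0"
    by (rule sym_eqI) (simp add: app_plus app_t app_zero step_step)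
  then show ?thesis by (metis minus_unique)
qed

lemma \<mu>_add: "\<mu> (m + m') = \<mu> m + \<mu> m'"
  by (rule sym_eqI) (simp add: app_plus app_\<mu> add.assoc)

lemma \<mu>_zero [simp]: "\<mu> 0 = 0"
  by (rule sym_eqI) (simp add: app_zero app_\<mu>)

lemma \<mu>_minus: "\<mu> (- m) = - \<mu> m"
  using \<mu>_add[of m "- m"] by (metis add.right_inverse \<mu>_zero minus_unique)

lemma \<mu>_commute: "\<mu> m + \<mu> m' = \<mu> m' + \<mu> m"
  by (metis \<mu>_add add.commute)

lemma \<mu>_t: "h \<in> H e \<Longrightarrow> \<mu> h + t e = t e + \<mu> (\<phi> e h)"
proof (rule sym_eqI)
  fix s assume h: "h \<in> H e"
  have r: "rep e (x + h) = rep e x" for x by (rule rep_cong) (simp add: h)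
  have "\<phi> e (x + h - rep e x) = \<phi> e (x - rep e x) + \<phi> e h" for x
    using \<phi>_add[OF rep_in'[of x e] h] by (simp add: algebra_simps)
  moreover have "x + h \<in> H e \<longleftrightarrow> x \<in> H e" for x
    using H_add_iff[OF h, of x] by (simp add: add.commute)
  ultimately show "app (\<mu> h + t e) s = app (t e + \<mu> (\<phi> e h)) s"
    using h
    using valid_step[of s e]
    by (cases "valid (snd s)"; cases "snd s")
       (auto simp: app_plus app_t app_\<mu> step_def pops_def pop_letter_def
         push_letter_def r \<phi>_add add.assoc simp del: valid.simps)
qed

end

section \<open>Reduced products and conjugacy\<close>

context hnn
begin

fun syl_prod :: "('e \<times> 'm) list \<Rightarrow> ('m \<times> ('e \<times> 'm) list) sym" where
  "syl_prod [] = 0"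
| "syl_prod ((e, m) # ys) = t e + (\<mu> m + syl_prod ys)"

definition no_pinch :: "'e \<times> 'm \<Rightarrow> 'e \<times> 'm \<Rightarrow> bool" where
  "no_pinch x y \<longleftrightarrow> \<not> (fst y = ie (fst x) \<and> snd x \<in> H (fst y))"

abbreviation reduced :: "('e \<times> 'm) list \<Rightarrow> bool" where
  "reduced \<equiv> successively no_pinch"

lemma no_pinch_Pair [simp]: "no_pinch (e, m) (e', m') \<longleftrightarrow> \<not> (e' = ie e \<and> m \<in> H e')"
  by (simp add: no_pinch_def)

text \<open>
  The number of stable letters in the normal form, that is, the displacement of the base vertex
  of the Bass-Serre tree.
\<close>
definition \<tau> :: "('m \<times> ('e \<times> 'm) list) sym \<Rightarrow> nat" where
  "\<tau> g = length (snd (app g (0, [])))"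

lemma syl_prod_append: "syl_prod (xs @ ys) = syl_prod xs + syl_prod ys"
  by (induction xs rule: syl_prod.induct) (auto simp: add.assoc)

lemma reduced_snoc_iff: "reduced (ys @ [(e, m)]) \<longleftrightarrow> reduced (ys @ [(e, m')])"
  by (auto simp: successively_append_iff no_pinch_def)

lemma reduced_sandwich:
  "ys \<noteq> [] \<Longrightarrow> reduced (x # ys @ [y]) \<longleftrightarrow> no_pinch x (hd ys) \<and> reduced ys \<and> no_pinch (last ys) y"
  by (auto simp: successively_Cons successively_append_iff)

lemma t_conj: "h \<in> H e \<Longrightarrow> - t e + \<mu> h + t e = \<mu> (\<phi> e h)"
  using \<mu>_t[of h e] by (metis add.assoc minus_add_cancel)

lemma valid_syl_prod: "valid (snd s) \<Longrightarrow> valid (snd (app (syl_prod ys) s))"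
  by (induction ys arbitrary: s rule: syl_prod.induct)
     (auto simp: app_plus app_zero app_t app_\<mu> valid_step)

text \<open>
  After a letter \<open>e\<close> the base part of the state lies in \<open>H (ie e)\<close>, and adding \<open>m\<close> takes it out of
  \<open>H (ie e)\<close> exactly when \<open>m\<close> is outside: a pinch of the product is the only way for the next letter to pop.
\<close>
lemma app_syl_prod_reduced:
  assumes "reduced ((e, m) # ys)" "valid st" "\<not> pops e (h, st)"
  shows "\<exists>h' zs. app (syl_prod ((e, m) # ys)) (h, st) = (h', zs @ (e, rep e h) # st) \<and> length zs = length ys"
  using assms
proof (induction ys arbitrary: e m h st)
  case Nil
  then show ?case
    using valid_step[of "(h, st)" e]
    by (auto simp: app_plus app_zero app_t app_\<mu> step_def push_letter_def)
next
  case (Cons y ys)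
  obtain e' m' where y: "y = (e', m')" by (cases y)
  let ?h = "\<phi> e (h - rep e h)" and ?st = "(e, rep e h) # st"
  have v: "valid ?st" and s: "step e (h, st) = (?h, ?st)"
    using valid_step[of "(h, st)" e] Cons.prems by (simp_all add: step_def push_letter_def)
  have "?h \<in> H (ie e)" by (intro \<phi>_in rep_in')
  then have "\<not> pops e' (?h + m, ?st)"
    using Cons.prems(1) H_add_iff by (auto simp: y pops_def)
  then obtain h' zs where "app (syl_prod (y # ys)) (?h + m, ?st) = (h', zs @ (e', rep e' (?h + m)) # ?st)"
    "length zs = length ys"
    using Cons.IH[of e' m' ?st "?h + m"] Cons.prems(1) v by (auto simp: y)
  then show ?case
    by (intro exI[of _ h'] exI[of _ "zs @ [(e', rep e' (?h + m))]"])
       (use v s in \<open>simp add: app_plus app_t app_\<mu>\<close>)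
qed

lemma app_normal_form:
  assumes "reduced ys"
  shows "\<exists>h st. app (\<mu> a + (syl_prod ys + \<mu> b)) (0, []) = (h, st) \<and> length st = length ys \<and>
    (ys \<noteq> [] \<longrightarrow> last st = (fst (hd ys), rep (fst (hd ys)) a))"
proof (cases ys)
  case Nil
  then show ?thesis by (simp add: app_plus app_zero app_\<mu>)
next
  case (Cons y ys')
  obtain e m where y: "y = (e, m)" by (cases y)
  have "\<not> pops e (a, [])" by (simp add: pops_def)
  then obtain h' zs where *: "app (syl_prod ((e, m) # ys')) (a, []) = (h', zs @ [(e, rep e a)])"
      "length zs = length ys'"
    using app_syl_prod_reduced[of e m ys' "[]" a] assms by (auto simp: Cons y)
  have "valid (snd (app (syl_prod ((e, m) # ys')) (a, [])))" by (rule valid_syl_prod) simp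
  then have v: "valid (zs @ [(e, rep e a)])" by (simp only: * snd_conv)
  show ?thesis
    using * v by (simp add: Cons y app_plus[of "\<mu> a"] app_plus[of _ "\<mu> b"] app_\<mu> del: syl_prod.simps)
qed

lemma \<tau>_reduced: "reduced ys \<Longrightarrow> \<tau> (\<mu> a + syl_prod ys) = length ys"
  using app_normal_form[of ys a 0] by (auto simp: \<tau>_def)

text \<open>
  The first letter of a reduced product writes the bottom entry of the list, which no later letter
  removes; this entry records the letter and the coset of what precedes it.
\<close>
lemma reduced_compare:
  assumes "reduced ys" "reduced ys'" "\<mu> a + (syl_prod ys + \<mu> b) = \<mu> a' + (syl_prod ys' + \<mu> b')"
  shows "length ys = length ys'"
    and "ys \<noteq> [] \<Longrightarrow> fst (hd ys) = fst (hd ys')"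
    and "ys \<noteq> [] \<Longrightarrow> a - a' \<in> H (fst (hd ys))"
proof -
  show l: "length ys = length ys'"
    using app_normal_form[OF assms(1), of a b] app_normal_form[OF assms(2), of a' b'] assms(3) by auto
  assume "ys \<noteq> []"
  moreover from this l have "ys' \<noteq> []" by auto
  ultimately have *: "fst (hd ys) = fst (hd ys') \<and> rep (fst (hd ys)) a = rep (fst (hd ys')) a'"
    using app_normal_form[OF assms(1), of a b] app_normal_form[OF assms(2), of a' b'] assms(3) by auto
  then show "fst (hd ys) = fst (hd ys')" by simp
  show "a - a' \<in> H (fst (hd ys))" using * by (metis rep_eq_iff)
qed

lemma \<mu>_inj: "\<mu> a = \<mu> b \<longleftrightarrow> a = b"
proof
  assume "\<mu> a = \<mu> b"
  then have "app (\<mu> a) (0, []) = app (\<mu> b) (0, [])" by simp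
  then show "a = b" by (simp add: app_\<mu>)
qed simp

text \<open>
  Unlike \<open>\<tau>\<close>, this relation is visibly compatible with products and inverses; it serves to bound \<open>\<tau>\<close>
  from above.
\<close>
definition expressible :: "nat \<Rightarrow> ('m \<times> ('e \<times> 'm) list) sym \<Rightarrow> bool" where
  "expressible k g \<longleftrightarrow> (\<exists>m ys. length ys = k \<and> g = \<mu> m + syl_prod ys)"

lemma expressible_\<mu>: "expressible 0 (\<mu> m)"
  unfolding expressible_def by (intro exI[of _ m] exI[of _ "[]"]) simp

lemma expressible_t: "expressible 1 (t e)"
  unfolding expressible_def by (intro exI[of _ 0] exI[of _ "[(e, 0)]"]) simp

lemma expressible_syl_prod: "expressible (length ys) (syl_prod ys)"
  unfolding expressible_def by (intro exI[of _ 0] exI[of _ ys]) simp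

lemma expressible_add:
  assumes "expressible k g" "expressible l h"
  shows "expressible (k + l) (g + h)"
proof -
  obtain m ys m' ys' where *: "length ys = k" "g = \<mu> m + syl_prod ys" "length ys' = l" "h = \<mu> m' + syl_prod ys'"
    using assms by (auto simp: expressible_def)
  show ?thesis
  proof (cases ys rule: rev_cases)
    case Nil
    then show ?thesis using *
      unfolding expressible_def by (intro exI[of _ "m + m'"] exI[of _ ys']) (simp add: \<mu>_add add.assoc)
  next
    case (snoc ys0 y)
    obtain e n where y: "y = (e, n)" by (cases y)
    show ?thesis using *
      unfolding expressible_def
      by (intro exI[of _ m] exI[of _ "ys0 @ (e, n + m') # ys'"])
         (simp add: snoc y syl_prod_append \<mu>_add add.assoc)
  qed
qed

lemma expressible_minus: "expressible k g \<Longrightarrow> expressible k (- g)"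
proof -
  have "expressible (length ys) (- (\<mu> m + syl_prod ys))" for m ys
  proof (induction ys arbitrary: m)
    case Nil
    then show ?case using expressible_\<mu>[of "- m"] by (simp add: \<mu>_minus)
  next
    case (Cons y ys)
    obtain e n where y: "y = (e, n)" by (cases y)
    have "expressible (length ys + (1 + 0)) (- (\<mu> n + syl_prod ys) + (t (ie e) + \<mu> (- m)))"
      by (intro expressible_add Cons.IH expressible_t expressible_\<mu>)
    then show ?case by (simp add: y t_ie \<mu>_minus minus_add add.assoc diff_conv_add_uminus del: add_uminus_conv_diff)
  qed
  then show "expressible k g \<Longrightarrow> expressible k (- g)" by (auto simp: expressible_def)
qed

lemma length_step: "length (snd (step e s)) \<le> Suc (length (snd s))"
  by (auto simp: step_def pop_letter_def push_letter_def)

lemma length_app_syl_prod: "length (snd (app (syl_prod ys) s)) \<le> length (snd s) + length ys"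
proof (induction ys arbitrary: s)
  case Nil
  then show ?case by (simp add: app_zero)
next
  case (Cons y ys)
  obtain e m where y: "y = (e, m)" by (cases y)
  have "length (snd (app (syl_prod ys) (app (\<mu> m) (step e s)))) \<le> length (snd (app (\<mu> m) (step e s))) + length ys"
    by (rule Cons.IH)
  also have "length (snd (app (\<mu> m) (step e s))) = length (snd (step e s))"
    by (simp add: app_\<mu>)
  finally show ?case using length_step[of e s] by (simp add: y app_plus app_t)
qed

lemma \<tau>_expressible: "expressible k g \<Longrightarrow> \<tau> g \<le> k"
  using length_app_syl_prod[of _ "(_, [])"] by (auto simp: expressible_def \<tau>_def app_plus app_\<mu>)

text \<open>
  A reduced product that starts with \<open>ie x\<close> and ends with \<open>x\<close> only gets longer when it is conjugated
  further along a reduced continuation of \<open>x\<close>: each new letter \<open>x'\<close> is wrapped around it, and both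
  new junctions are free of pinches for the same reason, namely that \<open>x\<close>, \<open>x'\<close> is not a pinch.
\<close>
lemma \<tau>_conj_reduced:
  assumes "reduced ((x, m) # xs)" "reduced ((ie x, c) # ys @ [(x, m)])"
  shows "\<tau> (- syl_prod xs + (\<mu> (- m) + syl_prod ((ie x, c) # ys @ [(x, m)])) + syl_prod xs) = length ys + 2 + 2 * length xs"
  using assms
proof (induction xs arbitrary: x m c ys)
  case Nil
  then show ?case using \<tau>_reduced[OF Nil(2), of "- m"] by simp
next
  case (Cons y xs)
  obtain x' m' where y: "y = (x', m')" by (cases y)
  let ?Y = "(ie x, c) # ys @ [(x, m)]"
  have "reduced ((ie x', - m) # ?Y @ [(x', m')])"
    using Cons.prems by (auto simp: y successively_Cons successively_append_iff hd_append split: if_splits)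
  moreover have "reduced ((x', m') # xs)" using Cons.prems by (simp add: y)
  ultimately have "\<tau> (- syl_prod xs + (\<mu> (- m') + syl_prod ((ie x', - m) # ?Y @ [(x', m')])) + syl_prod xs)
      = length ?Y + 2 + 2 * length xs"
    using Cons.IH by blast
  moreover have "- syl_prod (y # xs) + (\<mu> (- m) + syl_prod ?Y) + syl_prod (y # xs)
      = - syl_prod xs + (\<mu> (- m') + syl_prod ((ie x', - m) # ?Y @ [(x', m')])) + syl_prod xs"
    by (simp add: y syl_prod_append t_ie \<mu>_minus minus_add add.assoc diff_conv_add_uminus del: add_uminus_conv_diff)
  ultimately show ?case by simp
qed

text \<open>
  Geometrically, \<open>c\<close> fixes the path in the Bass-Serre tree that the letters spell.
\<close>
fun chain :: "'m \<Rightarrow> 'e list \<Rightarrow> 'm \<Rightarrow> bool" where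
  "chain c [] c' \<longleftrightarrow> c = c'"
| "chain c (x # xs) c' \<longleftrightarrow> c \<in> H x \<and> chain (\<phi> x c) xs c'"

text \<open>
  The condition \<open>\<tau> (V + V) = 2 * \<tau> V\<close> holds when \<open>V\<close> is cyclically reduced or in the base group.
  As long as the conjugated element lies in the next edge group, one letter of the conjugator is used
  up. Otherwise \<open>V\<close> has length \<open>2 * length xs\<close>, while \<open>V + V\<close>, being conjugate by the same element to
  an element of the base group, has at most this length too.
\<close>
lemma elliptic_conj:
  assumes "reduced xs" "V = - (\<mu> a + syl_prod xs) + \<mu> c + (\<mu> a + syl_prod xs)" "\<tau> (V + V) = 2 * \<tau> V"
  shows "\<exists>c'. V = \<mu> c' \<and> chain c (map fst xs) c'"
  using assms
proof (induction xs arbitrary: a c)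
  case Nil
  have "V = \<mu> c"
    using Nil(2) \<mu>_commute[of c a] by (simp add: add.assoc minus_add diff_conv_add_uminus del: add_uminus_conv_diff)
  then show ?case by auto
next
  case (Cons y xs)
  obtain x m where y: "y = (x, m)" by (cases y)
  have "- \<mu> a + \<mu> c + \<mu> a = \<mu> c"
    using \<mu>_commute[of c a] by (simp add: add.assoc)
  then have V: "V = - (t x + (\<mu> m + syl_prod xs)) + \<mu> c + (t x + (\<mu> m + syl_prod xs))"
    using Cons.prems(2) by (simp add: y minus_add add.assoc diff_conv_add_uminus del: add_uminus_conv_diff) (metis add.assoc)
  show ?case
  proof (cases "c \<in> H x")
    case True
    have "V = - (\<mu> m + syl_prod xs) + (- t x + \<mu> c + t x) + (\<mu> m + syl_prod xs)"
      using V by (simp add: minus_add add.assoc diff_conv_add_uminus del: add_uminus_conv_diff)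
    also have "- t x + \<mu> c + t x = \<mu> (\<phi> x c)" by (rule t_conj[OF True])
    finally have "V = - (\<mu> m + syl_prod xs) + \<mu> (\<phi> x c) + (\<mu> m + syl_prod xs)" .
    from Cons.IH[OF _ this Cons.prems(3)] Cons.prems(1) True show ?thesis
      by (cases xs) (auto simp: y)
  next
    case False
    have "V = - syl_prod xs + (\<mu> (- m) + syl_prod ((ie x, c) # [] @ [(x, m)])) + syl_prod xs"
      using V by (simp add: minus_add add.assoc t_ie \<mu>_minus diff_conv_add_uminus del: add_uminus_conv_diff)
    moreover have "reduced ((ie x, c) # [] @ [(x, m)])" using False by simp
    ultimately have \<tau>: "\<tau> V = 2 + 2 * length xs"
      using \<tau>_conj_reduced[of x m xs c "[]"] Cons.prems(1) by (simp add: y)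
    have "V + V = - syl_prod (y # xs) + (\<mu> (c + c) + syl_prod (y # xs))"
      using V by (simp add: y minus_add add.assoc \<mu>_add diff_conv_add_uminus del: add_uminus_conv_diff)
    moreover have "expressible (length (y # xs) + (0 + length (y # xs))) (- syl_prod (y # xs) + (\<mu> (c + c) + syl_prod (y # xs)))"
      by (intro expressible_add expressible_minus expressible_syl_prod expressible_\<mu>)
    ultimately have "\<tau> (V + V) \<le> length (y # xs) + (0 + length (y # xs))"
      using \<tau>_expressible by metis
    then show ?thesis using \<tau> Cons.prems(3) by simp
  qed
qed

text \<open>
  Repeating the product also tests the junction from the last syllable to the first.
\<close>
abbreviation cyc_reduced :: "('e \<times> 'm) list \<Rightarrow> bool" where
  "cyc_reduced ys \<equiv> reduced (ys @ ys)"

lemma cyc_reduced_rotate1: "cyc_reduced ys \<Longrightarrow> cyc_reduced (rotate1 ys)"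
  by (cases ys) (auto simp: successively_append_iff successively_Cons hd_append)

lemma cyc_reduced_rotate: "cyc_reduced ys \<Longrightarrow> cyc_reduced (rotate r ys)"
  by (induction r) (auto simp: cyc_reduced_rotate1)

lemma \<tau>_cyc_reduced: "cyc_reduced ys \<Longrightarrow> \<tau> (syl_prod ys + syl_prod ys) = 2 * \<tau> (syl_prod ys)"
  using \<tau>_reduced[of "ys @ ys" 0] \<tau>_reduced[of ys 0] by (simp add: syl_prod_append successively_append_iff)

text \<open>
  This is Collins' lemma. If the first letter of the conjugator cancels on the left or on the right of
  the cyclically reduced product, it can be absorbed into a rotation. If it does not, conjugation
  yields a reduced product of length \<open>length ys + 2 * length xs\<close>, but \<open>V + V\<close> has at most the length
  \<open>2 * length ys + 2 * length xs\<close>, against \<open>\<tau> (V + V) = 2 * \<tau> V\<close>.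
\<close>
lemma hyperbolic_conj:
  assumes "reduced xs" "cyc_reduced ys" "ys \<noteq> []"
    and "V = - (\<mu> a + syl_prod xs) + syl_prod ys + (\<mu> a + syl_prod xs)" "\<tau> (V + V) = 2 * \<tau> V"
  shows "\<exists>r h. V = - \<mu> h + syl_prod (rotate r ys) + \<mu> h"
  using assms
proof (induction xs arbitrary: a ys)
  case Nil
  then show ?case by (intro exI[of _ 0] exI[of _ a]) simp
next
  case (Cons y xs)
  obtain x m where y: "y = (x, m)" by (cases y)
  obtain e w zs where ys: "ys = (e, w) # zs" using Cons.prems(3) by (cases ys) auto
  obtain e' w' zs' where ys': "ys = zs' @ [(e', w')]" using Cons.prems(3) by (cases ys rule: rev_cases) auto
  have rxs: "reduced xs" using Cons.prems(1) by (auto simp: successively_Cons)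
  \<comment> \<open>The first letter of the conjugator cancels with the first or the last letter of \<open>ys\<close>, or not.\<close>
  consider (left) "x = e" "a \<in> H e" | (right) "x = ie e'" "w' + a \<in> H x"
    | (none) "\<not> (x = e \<and> a \<in> H e)" "\<not> (x = ie e' \<and> w' + a \<in> H x)" by blast
  then show ?case
  proof cases
    case left
    let ?p = "t e + \<mu> w"
    have g: "\<mu> a + syl_prod (y # xs) = ?p + (\<mu> (\<phi> e a + m - w) + syl_prod xs)"
    proof -
      have "\<mu> a + syl_prod (y # xs) = (\<mu> a + t e) + (\<mu> m + syl_prod xs)" by (simp add: y left add.assoc)
      also have "\<mu> a + t e = t e + \<mu> (\<phi> e a)" by (rule \<mu>_t[OF left(2)])
      also have "t e + \<mu> (\<phi> e a) + (\<mu> m + syl_prod xs) = t e + (\<mu> (w + (\<phi> e a + m - w)) + syl_prod xs)"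
        by (simp add: \<mu>_add add.assoc)
      finally show ?thesis by (simp only: \<mu>_add add.assoc)
    qed
    have r: "syl_prod (rotate1 ys) = - ?p + syl_prod ys + ?p"
      by (simp add: ys syl_prod_append minus_add add.assoc diff_conv_add_uminus del: add_uminus_conv_diff)
    have "V = - (\<mu> (\<phi> e a + m - w) + syl_prod xs) + syl_prod (rotate1 ys) + (\<mu> (\<phi> e a + m - w) + syl_prod xs)"
      unfolding Cons.prems(4) g r by (simp add: minus_add add.assoc diff_conv_add_uminus del: add_uminus_conv_diff)
    from Cons.IH[OF rxs cyc_reduced_rotate1[OF Cons.prems(2)] _ this Cons.prems(5)] Cons.prems(3)
    obtain r h where "V = - \<mu> h + syl_prod (rotate r (rotate1 ys)) + \<mu> h" by auto
    then show ?thesis by (metis rotate1_rotate_swap rotate_Suc)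
  next
    case right
    let ?p = "t e' + \<mu> w'" and ?zs = "rotate (length zs') ys"
    have zs: "?zs = (e', w') # zs'" by (simp add: ys' rotate_append)
    have g: "\<mu> a + syl_prod (y # xs) = - ?p + (\<mu> (\<phi> x (w' + a) + m) + syl_prod xs)"
    proof -
      have "\<mu> w' + (\<mu> a + t x) = t x + \<mu> (\<phi> x (w' + a))"
        using \<mu>_t[OF right(2)] by (simp add: \<mu>_add add.assoc)
      then have "t e' + ((\<mu> w' + (\<mu> a + t x)) + (\<mu> m + syl_prod xs)) = t e' + ((t x + \<mu> (\<phi> x (w' + a))) + (\<mu> m + syl_prod xs))"
        by (simp only:)
      then have "?p + (\<mu> a + syl_prod (y # xs)) = t e' + ((t x + \<mu> (\<phi> x (w' + a))) + (\<mu> m + syl_prod xs))"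
        by (simp only: y syl_prod.simps add.assoc)
      also have "t x = - t e'" using right by (simp add: t_ie)
      finally have *: "?p + (\<mu> a + syl_prod (y # xs)) = \<mu> (\<phi> x (w' + a) + m) + syl_prod xs"
        by (simp add: \<mu>_add add.assoc)
      show ?thesis unfolding *[symmetric]
        by (simp add: add.assoc minus_add diff_conv_add_uminus del: add_uminus_conv_diff)
    qed
    have r: "syl_prod ?zs = ?p + syl_prod ys + - ?p"
      unfolding zs by (simp add: ys' syl_prod_append minus_add add.assoc diff_conv_add_uminus del: add_uminus_conv_diff)
    have "V = - (\<mu> (\<phi> x (w' + a) + m) + syl_prod xs) + syl_prod ?zs + (\<mu> (\<phi> x (w' + a) + m) + syl_prod xs)"
      unfolding Cons.prems(4) g r by (simp add: minus_add add.assoc diff_conv_add_uminus del: add_uminus_conv_diff)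
    from Cons.IH[OF rxs cyc_reduced_rotate[OF Cons.prems(2)] _ this Cons.prems(5)] Cons.prems(3)
    obtain r h where "V = - \<mu> h + syl_prod (rotate r ?zs) + \<mu> h" by auto
    then show ?thesis by (metis rotate_rotate)
  next
    case none
    have ne: "(e, w) # zs = zs' @ [(e', w')]" using ys ys' by simp
    have "reduced ys" using Cons.prems(2) by (simp add: successively_append_iff)
    then have rY: "reduced (zs' @ [(e', w' + a)])" using reduced_snoc_iff ys' by metis
    have hdY: "fst (hd (zs' @ [(e', w' + a)])) = e" using ne by (cases zs') auto
    have rY2: "reduced ((ie x, - a) # (zs' @ [(e', w' + a)]) @ [(x, m)])"
      using none rY by (subst reduced_sandwich) (auto simp: no_pinch_def hdY)
    have "V = - syl_prod xs + (\<mu> (- m) + syl_prod ((ie x, - a) # (zs' @ [(e', w' + a)]) @ [(x, m)])) + syl_prod xs"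
      unfolding Cons.prems(4) by (simp add: ys' y syl_prod_append t_ie \<mu>_minus \<mu>_add minus_add add.assoc diff_conv_add_uminus del: add_uminus_conv_diff)
    then have \<tau>: "\<tau> V = length ys + 2 + 2 * length xs"
      using \<tau>_conj_reduced[OF _ rY2] Cons.prems(1) by (simp add: y ys' del: syl_prod.simps)
    let ?g = "\<mu> a + syl_prod (y # xs)"
    have g: "expressible (0 + length (y # xs)) ?g" by (intro expressible_add expressible_\<mu> expressible_syl_prod)
    have "V + V = - ?g + (syl_prod ys + (syl_prod ys + ?g))"
      unfolding Cons.prems(4) by (simp add: minus_add add.assoc diff_conv_add_uminus del: add_uminus_conv_diff)
    moreover have "expressible (0 + length (y # xs) + (length ys + (length ys + (0 + length (y # xs)))))
        (- ?g + (syl_prod ys + (syl_prod ys + ?g)))"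
      by (intro expressible_add expressible_syl_prod expressible_minus expressible_\<mu>)
    ultimately have "\<tau> (V + V) \<le> 0 + length (y # xs) + (length ys + (length ys + (0 + length (y # xs))))"
      using \<tau>_expressible by metis
    then show ?thesis using \<tau> Cons.prems(5) by simp
  qed
qed

text \<open>
  Equality of two reduced products, one multiplied by \<open>h'\<close> on the right and the other by \<open>h\<close> on the
  left, spelled out syllable by syllable: \<open>h\<close> moves through the letters and turns into \<open>h'\<close>.
\<close>
fun push :: "'m \<Rightarrow> ('e \<times> 'm) list \<Rightarrow> ('e \<times> 'm) list \<Rightarrow> 'm \<Rightarrow> bool" where
  "push h [] [] h' \<longleftrightarrow> h = h'"
| "push h ((e, m) # ys) ((e', m') # ys') h' \<longleftrightarrow> e' = e \<and> h \<in> H e \<and> push (\<phi> e h + m' - m) ys ys' h'"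
| "push h _ _ h' \<longleftrightarrow> False"

lemma push_length: "push h ys ys' h' \<Longrightarrow> length ys = length ys'"
  by (induction h ys ys' h' rule: push.induct) auto

lemma push_sound: "push h ys ys' h' \<Longrightarrow> syl_prod ys + \<mu> h' = \<mu> h + syl_prod ys'"
proof (induction h ys ys' h' rule: push.induct)
  case (2 h e m ys e' m' ys' h')
  then have IH: "syl_prod ys + \<mu> h' = \<mu> (\<phi> e h + m' - m) + syl_prod ys'" and h: "h \<in> H e" "e' = e" by auto
  have "syl_prod ((e, m) # ys) + \<mu> h' = t e + (\<mu> m + (syl_prod ys + \<mu> h'))" by (simp add: add.assoc)
  also have "\<mu> m + (syl_prod ys + \<mu> h') = \<mu> (m + (\<phi> e h + m' - m)) + syl_prod ys'"
    by (simp only: IH \<mu>_add add.assoc)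
  also have "m + (\<phi> e h + m' - m) = \<phi> e h + m'" by simp
  also have "t e + (\<mu> (\<phi> e h + m') + syl_prod ys') = (t e + \<mu> (\<phi> e h)) + (\<mu> m' + syl_prod ys')"
    by (simp add: \<mu>_add add.assoc)
  also have "t e + \<mu> (\<phi> e h) = \<mu> h + t e" using \<mu>_t[OF h(1)] by simp
  finally show ?case by (simp add: h add.assoc)
qed auto

lemma push_complete:
  assumes "reduced ys" "reduced ys'" "syl_prod ys + \<mu> h' = \<mu> h + syl_prod ys'"
  shows "push h ys ys' h'"
  using assms
proof (induction h ys ys' h' rule: push.induct)
  case (1 h h')
  then show ?case by (simp add: \<mu>_inj)
next
  case (2 h e m ys e' m' ys' h')
  have eq: "\<mu> 0 + (syl_prod ((e, m) # ys) + \<mu> h') = \<mu> h + (syl_prod ((e', m') # ys') + \<mu> 0)" using 2(4) by simp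
  have e: "e' = e" and "0 - h \<in> H e" using reduced_compare(2,3)[OF 2(2,3) eq] by auto
  then have h: "h \<in> H e" by simp
  have "t e + (\<mu> m + (syl_prod ys + \<mu> h')) = (\<mu> h + t e) + (\<mu> m' + syl_prod ys')"
    using 2(4) by (simp add: e add.assoc)
  also have "\<dots> = t e + (\<mu> (\<phi> e h) + (\<mu> m' + syl_prod ys'))"
    unfolding \<mu>_t[OF h] by (simp add: add.assoc)
  finally have "\<mu> m + (syl_prod ys + \<mu> h') = \<mu> (\<phi> e h) + (\<mu> m' + syl_prod ys')" by (rule add_left_imp_eq)
  also have "\<dots> = \<mu> (m + (\<phi> e h + m' - m)) + syl_prod ys'" by (simp add: \<mu>_add add.assoc)
  also have "\<dots> = \<mu> m + (\<mu> (\<phi> e h + m' - m) + syl_prod ys')" by (simp only: \<mu>_add add.assoc)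
  finally have "syl_prod ys + \<mu> h' = \<mu> (\<phi> e h + m' - m) + syl_prod ys'" by simp
  with 2 e h show ?case by (auto simp: successively_Cons)
next
  case ("3_1" h v va h')
  then show ?case using reduced_compare(1)[of "v # va" "[]" 0 h' h 0] by auto
next
  case ("3_2" h v va h')
  then show ?case using reduced_compare(1)[of "[]" "v # va" 0 h' h 0] by auto
qed

lemma push_append:
  "length xs = length xs' \<Longrightarrow> push h (xs @ ys) (xs' @ ys') h' \<longleftrightarrow> (\<exists>k. push h xs xs' k \<and> push k ys ys' h')"
  by (induction xs xs' arbitrary: h rule: list_induct2) auto

lemma push_rotate1:
  assumes "push h ys ys' h"
  shows "\<exists>h'. push h' (rotate1 ys) (rotate1 ys') h'"
proof (cases ys)
  case Nil
  then show ?thesis using assms push_length[OF assms] by auto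
next
  case (Cons y zs)
  then obtain y' zs' where ys': "ys' = y' # zs'" using push_length[OF assms] by (cases ys') auto
  obtain e m e' m' where y: "y = (e, m)" "y' = (e', m')" by (cases y, cases y')
  have *: "e' = e" "h \<in> H e" "push (\<phi> e h + m' - m) zs zs' h"
    using assms by (auto simp: Cons ys' y)
  show ?thesis
    using * push_length[OF *(3)]
    by (intro exI[of _ "\<phi> e h + m' - m"]) (auto simp: Cons ys' y push_append)
qed

lemma push_rotate:
  assumes "push h ys ys' h"
  shows "\<exists>h'. push h' (rotate r ys) (rotate r ys') h'"
  by (induction r) (use assms push_rotate1 in auto)

end

section \<open>Words, pinches and cyclic reduction\<close>

text \<open>
  Letters of a concrete generating set: each is an element of the base group or a stable letter.
  The group element of a word is needed for exact equations, the word itself for its length.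
\<close>
locale hnn_words = hnn H \<phi> ie
  for H :: "'e \<Rightarrow> 'm::ab_group_add set" and \<phi> and ie +
  fixes kind :: "'l \<Rightarrow> 'm + 'e" and letter_of :: "'e \<Rightarrow> 'l" and inv_letter :: "'l \<Rightarrow> 'l"
  assumes kind_Inr_iff: "kind l = Inr e \<longleftrightarrow> l = letter_of e"
    and kind_inv_letter: "kind (inv_letter l) = map_sum uminus ie (kind l)"
begin

lemma kind_letter_of [simp]: "kind (letter_of e) = Inr e"
  by (simp add: kind_Inr_iff)

definition lval :: "'l \<Rightarrow> ('m \<times> ('e \<times> 'm) list) sym" where
  "lval l = (case kind l of Inl m \<Rightarrow> \<mu> m | Inr e \<Rightarrow> t e)"

definition val :: "'l list \<Rightarrow> ('m \<times> ('e \<times> 'm) list) sym" where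
  "val w = sum_list (map lval w)"

lemma val_simps [simp]: "val [] = 0" "val (l # w) = lval l + val w" "val (u @ w) = val u + val w"
  by (simp_all add: val_def)

lemma lval_letter_of [simp]: "lval (letter_of e) = t e"
  by (simp add: lval_def)

lemma lval_inv_letter: "lval (inv_letter l) = - lval l"
  by (cases "kind l") (simp_all add: lval_def kind_inv_letter \<mu>_minus t_ie)

lemma val_inverse: "val (rev (map inv_letter w)) = - val w"
proof (induction w)
  case (Cons l w)
  then show ?case by (simp add: lval_inv_letter minus_add)
qed simp

text \<open>
  Words that can be reduced into the base group by successive pinches, together with their value.
  By Britton's lemma these are all the words with value in the base group (\<open>pinches_iff\<close>), so that
  estimates can be proved by induction.
\<close>
inductive pinches :: "'l list \<Rightarrow> 'm \<Rightarrow> bool" where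
  pinches_Nil: "pinches [] 0"
| pinches_base: "kind l = Inl m \<Longrightarrow> pinches w m' \<Longrightarrow> pinches (l # w) (m + m')"
| pinches_pinch: "pinches w h \<Longrightarrow> h \<in> H e \<Longrightarrow> pinches w' m' \<Longrightarrow> pinches (letter_of (ie e) # w @ letter_of e # w') (\<phi> e h + m')"

lemma pinches_append: "pinches w m \<Longrightarrow> pinches w' m' \<Longrightarrow> pinches (w @ w') (m + m')"
proof (induction rule: pinches.induct)
  case (pinches_base l m w n)
  then show ?case using pinches.pinches_base[of l m "w @ w'" "n + m'"] by (simp add: add.assoc)
next
  case (pinches_pinch w h e v n)
  then show ?case using pinches.pinches_pinch[of w h e "v @ w'" "n + m'"] by (simp add: add.assoc)
qed simp

lemma val_pinches: "pinches w m \<Longrightarrow> val w = \<mu> m"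
proof (induction rule: pinches.induct)
  case (pinches_base l m w m')
  then show ?case by (simp add: lval_def \<mu>_add)
next
  case (pinches_pinch w h e w' m')
  have "- t e + \<mu> h + t e = \<mu> (\<phi> e h)" by (rule t_conj) fact
  with pinches_pinch show ?case
    by (simp add: t_ie \<mu>_add flip: add.assoc)
qed simp

text \<open>
  A segment consists of a stable letter, a word with value in the base group, and this value.
  Literal subwords are kept because rotating a word by whole segments is conjugation by a subword.
\<close>
definition flat :: "('e \<times> 'l list \<times> 'm) list \<Rightarrow> 'l list" where
  "flat segs = concat (map (\<lambda>(e, w, m). letter_of e # w) segs)"

definition syllables :: "('e \<times> 'l list \<times> 'm) list \<Rightarrow> ('e \<times> 'm) list" where
  "syllables segs = map (\<lambda>(e, w, m). (e, m)) segs"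

definition segs_pinch :: "('e \<times> 'l list \<times> 'm) list \<Rightarrow> bool" where
  "segs_pinch segs \<longleftrightarrow> (\<forall>(e, w, m) \<in> set segs. pinches w m)"

lemma seg_simps [simp]:
  "flat [] = []" "flat ((e, w, m) # segs) = letter_of e # w @ flat segs" "flat (segs @ segs') = flat segs @ flat segs'"
  "syllables [] = []" "syllables ((e, w, m) # segs) = (e, m) # syllables segs" "syllables (segs @ segs') = syllables segs @ syllables segs'"
  "segs_pinch []" "segs_pinch ((e, w, m) # segs) \<longleftrightarrow> pinches w m \<and> segs_pinch segs"
  "segs_pinch (segs @ segs') \<longleftrightarrow> segs_pinch segs \<and> segs_pinch segs'"
  "length (syllables segs) = length segs" "syllables segs = [] \<longleftrightarrow> segs = []"
  by (auto simp: flat_def syllables_def segs_pinch_def ball_Un)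

lemma val_flat: "segs_pinch segs \<Longrightarrow> val (flat segs) = syl_prod (syllables segs)"
  by (induction segs) (auto simp: val_pinches)

lemma length_flat: "length segs \<le> length (flat segs)"
  by (induction segs) auto

lemma syllables_rotate: "syllables (rotate r segs) = rotate r (syllables segs)"
  by (simp add: syllables_def rotate_map)

lemma segs_pinch_rotate [simp]: "segs_pinch (rotate r segs) \<longleftrightarrow> segs_pinch segs"
  by (simp add: segs_pinch_def)

lemma flat_rotate: "\<exists>r'. flat (rotate r segs) = rotate r' (flat segs)"
proof (induction r)
  case 0
  show ?case by (intro exI[of _ 0]) simp
next
  case (Suc r)
  have "\<exists>r'. flat (rotate1 xs) = rotate r' (flat xs)" for xs
  proof (cases xs)
    case (Cons y ys)
    obtain e w m where y: "y = (e, w, m)" by (cases y)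
    show ?thesis
      using rotate_append[of "letter_of e # w" "flat ys"]
      by (intro exI[of _ "length (letter_of e # w)"]) (simp add: Cons y)
  qed simp
  then obtain r1 where "flat (rotate1 (rotate r segs)) = rotate r1 (flat (rotate r segs))" by blast
  moreover obtain r2 where "flat (rotate r segs) = rotate r2 (flat segs)" using Suc by blast
  ultimately show ?case by (auto simp: rotate_rotate)
qed

text \<open>
  Reading the word from the right, a new stable letter either closes a pinch with the following one,
  whose segments then merge, or opens a new segment.
\<close>
lemma parse:
  "\<exists>w0 m0 segs. w = w0 @ flat segs \<and> pinches w0 m0 \<and> segs_pinch segs \<and> reduced (syllables segs)"
proof (induction w)
  case Nil
  show ?case by (intro exI[of _ "[]"] exI[of _ 0]) (simp add: pinches_Nil)
next
  case (Cons l w)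
  then obtain w0 m0 segs where IH: "w = w0 @ flat segs" "pinches w0 m0" "segs_pinch segs" "reduced (syllables segs)"
    by blast
  show ?case
  proof (cases "kind l")
    case (Inl m)
    then show ?thesis using IH
      by (intro exI[of _ "l # w0"] exI[of _ "m + m0"] exI[of _ segs]) (simp add: pinches_base)
  next
    case (Inr e)
    then have l: "l = letter_of e" by (simp add: kind_Inr_iff)
    show ?thesis
    proof (cases "\<exists>e1 w1 m1 segs'. segs = (e1, w1, m1) # segs' \<and> e1 = ie e \<and> m0 \<in> H e1")
      case True
      then obtain w1 m1 segs' where s: "segs = (ie e, w1, m1) # segs'" "m0 \<in> H (ie e)" by blast
      have "pinches (letter_of (ie (ie e)) # w0 @ letter_of (ie e) # w1) (\<phi> (ie e) m0 + m1)"
        using IH s by (intro pinches_pinch) auto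
      then show ?thesis using IH s
        by (intro exI[of _ "l # w0 @ letter_of (ie e) # w1"] exI[of _ "\<phi> (ie e) m0 + m1"] exI[of _ segs'])
           (auto simp: l successively_Cons)
    next
      case False
      then have "reduced (syllables ((e, w0, m0) # segs))"
        using IH(4) by (cases segs) (auto simp: successively_Cons)
      then show ?thesis using IH
        by (intro exI[of _ "[]"] exI[of _ 0] exI[of _ "(e, w0, m0) # segs"]) (simp add: l pinches_Nil)
    qed
  qed
qed

lemma pinches_iff: "pinches w m \<longleftrightarrow> val w = \<mu> m"
proof
  assume v: "val w = \<mu> m"
  obtain w0 m0 segs where p: "w = w0 @ flat segs" "pinches w0 m0" "segs_pinch segs" "reduced (syllables segs)"
    using parse by blast
  have "\<mu> m0 + (syl_prod (syllables segs) + \<mu> 0) = \<mu> m + (syl_prod [] + \<mu> 0)"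
    using v p by (simp add: val_pinches val_flat)
  from reduced_compare(1)[OF p(4) _ this] have "segs = []" by simp
  then show "pinches w m" using p v by (auto simp: val_pinches \<mu>_inj)
qed (rule val_pinches)

definition cyc_form :: "'l list \<Rightarrow> bool" where
  "cyc_form u \<longleftrightarrow> (\<exists>m. pinches u m) \<or> (\<exists>segs. segs \<noteq> [] \<and> segs_pinch segs \<and> cyc_reduced (syllables segs) \<and> u = flat segs)"

text \<open>
  If the last letter cancels with the first across the end of the word, rotating the first segment to
  the end makes the pinch visible, and it is swallowed by the segment before it.
\<close>
lemma cyc_form_flat:
  "segs_pinch segs \<Longrightarrow> reduced (syllables segs) \<Longrightarrow> \<exists>r. cyc_form (rotate r (flat segs))"
proof (induction "length segs" arbitrary: segs rule: less_induct)
  case less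
  show ?case
  proof (cases segs)
    case Nil
    then show ?thesis using pinches_Nil by (auto simp: cyc_form_def)
  next
    case (Cons y ys)
    obtain e1 w1 m1 where y: "y = (e1, w1, m1)" by (cases y)
    show ?thesis
    proof (cases "cyc_reduced (syllables segs)")
      case True
      then have "cyc_form (rotate 0 (flat segs))"
        using less.prems Cons by (auto simp: cyc_form_def)
      then show ?thesis by blast
    next
      case False
      obtain zs z where z: "segs = zs @ [z]" using Cons by (metis rev_exhaust list.distinct(1))
      obtain e w m where "z = (e, w, m)" by (cases z)
      with z have snoc: "segs = zs @ [(e, w, m)]" by simp
      have e1: "e1 = ie e" "m \<in> H (ie e)"
      proof -
        have "hd (syllables segs) = (e1, m1)" "last (syllables segs) = (e, m)" "syllables segs \<noteq> []"
          by (simp add: Cons y, simp add: snoc, simp add: snoc)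
        then show "e1 = ie e" "m \<in> H (ie e)"
          using False less.prems(2) by (auto simp: successively_append_iff)
      qed
      obtain mid where zs: "zs = (e1, w1, m1) # mid"
        using snoc Cons y e1 ie_neq[of e] by (cases zs) auto
      have seg: "segs = (ie e, w1, m1) # mid @ [(e, w, m)]" using snoc zs e1 by simp
      let ?p = "letter_of (ie (ie e)) # w @ letter_of (ie e) # w1"
      have p: "pinches ?p (\<phi> (ie e) m + m1)"
        using less.prems(1) e1 by (intro pinches_pinch) (auto simp: seg)
      have rot: "flat mid @ ?p = rotate (length (letter_of (ie e) # w1)) (flat segs)"
        using rotate_append[of "letter_of (ie e) # w1" "flat mid @ (letter_of e # w)"] by (simp add: seg)
      show ?thesis
      proof (cases mid rule: rev_cases)
        case Nil
        then show ?thesis using p rot unfolding cyc_form_def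
          by (intro exI[of _ "length (letter_of (ie e) # w1)"]) auto
      next
        case (snoc mid' z)
        obtain e2 w2 m2 where z: "z = (e2, w2, m2)" by (cases z)
        let ?s = "mid' @ [(e2, w2 @ ?p, m2 + (\<phi> (ie e) m + m1))]"
        have "reduced (syllables (mid' @ [(e2, w2, m2)]))"
          using less.prems(2) by (simp add: seg snoc z successively_Cons successively_append_iff)
        then have "reduced (syllables ?s)" using reduced_snoc_iff[of "syllables mid'" e2 m2] by simp
        moreover have "segs_pinch ?s"
          using less.prems(1) pinches_append[OF _ p] by (simp add: seg snoc z)
        moreover have "length ?s < length segs" by (simp add: seg snoc)
        ultimately obtain r where "cyc_form (rotate r (flat ?s))"
          using less.hyps[of ?s] by blast
        moreover have "flat ?s = rotate (length (letter_of (ie e) # w1)) (flat segs)"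
          using rot by (simp add: snoc z)
        ultimately show ?thesis by (metis rotate_rotate)
      qed
    qed
  qed
qed

lemma cyclic_reduction: "\<exists>r. cyc_form (rotate r u)"
proof -
  obtain w0 m0 segs where p: "u = w0 @ flat segs" "pinches w0 m0" "segs_pinch segs" "reduced (syllables segs)"
    using parse by blast
  show ?thesis
  proof (cases segs rule: rev_cases)
    case Nil
    then have "cyc_form (rotate 0 u)" using p by (auto simp: cyc_form_def)
    then show ?thesis by blast
  next
    case (snoc zs z)
    obtain e w m where z: "z = (e, w, m)" by (cases z)
    let ?s = "zs @ [(e, w @ w0, m + m0)]"
    have "segs_pinch ?s" "reduced (syllables ?s)"
      using p pinches_append[of w m w0 m0] reduced_snoc_iff[of "syllables zs" e m] by (auto simp: snoc z)
    then obtain r where "cyc_form (rotate r (flat ?s))" using cyc_form_flat by blast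
    moreover have "flat ?s = rotate (length w0) u"
      using rotate_append[of w0 "flat segs"] by (simp add: p snoc z)
    ultimately show ?thesis by (metis rotate_rotate)
  qed
qed

definition conjw :: "nat \<Rightarrow> 'l list \<Rightarrow> 'l list \<Rightarrow> bool" where
  "conjw N u v \<longleftrightarrow> (\<exists>w. length w \<le> N \<and> val u + val w = val w + val v)"

lemma conjwI: "length w \<le> N \<Longrightarrow> val u + val w = val w + val v \<Longrightarrow> conjw N u v"
  by (auto simp: conjw_def)

lemma conjw_rotate: "conjw (length u) u (rotate r u)"
proof (rule conjwI[of "take (r mod length u) u"])
  have "val u = val (take (r mod length u) u) + val (drop (r mod length u) u)"
    by (simp flip: val_simps(3))
  then show "val u + val (take (r mod length u) u) = val (take (r mod length u) u) + val (rotate r u)"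
    by (simp add: rotate_drop_take add.assoc)
qed simp

lemma conjw_sym: "conjw N u v \<Longrightarrow> conjw N v u"
proof -
  assume "conjw N u v"
  then obtain w where w: "length w \<le> N" "val u + val w = val w + val v" by (auto simp: conjw_def)
  then have "val v = - val w + (val u + val w)" by simp
  then show ?thesis using w(1)
    by (intro conjwI[of "rev (map inv_letter w)"]) (simp_all add: val_inverse add.assoc del: add_uminus_conv_diff)
qed

lemma conjw_trans: "conjw N u v \<Longrightarrow> conjw M v w \<Longrightarrow> conjw (N + M) u w"
proof -
  assume "conjw N u v" "conjw M v w"
  then obtain x y where x: "length x \<le> N" "val u + val x = val x + val v"
    and y: "length y \<le> M" "val v + val y = val y + val w" by (auto simp: conjw_def)
  have "val u + (val x + val y) = val x + (val v + val y)"
    using x(2) by (metis add.assoc)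
  with x y show ?thesis by (intro conjwI[of "x @ y"]) (simp_all add: add.assoc)
qed

lemma conjw_mono: "conjw N u v \<Longrightarrow> N \<le> M \<Longrightarrow> conjw M u v"
  by (meson conjw_def le_trans)

lemma \<tau>_cyc_form:
  assumes "cyc_form v"
  shows "\<tau> (val v + val v) = 2 * \<tau> (val v)"
  using assms unfolding cyc_form_def
proof (elim disjE exE conjE)
  fix m assume "pinches v m"
  then show ?thesis
    using \<tau>_reduced[of "[]" m] \<tau>_reduced[of "[]" "m + m"] by (simp add: val_pinches flip: \<mu>_add)
next
  fix segs assume "segs_pinch segs" "cyc_reduced (syllables segs)" "v = flat segs"
  then show ?thesis using \<tau>_cyc_reduced by (simp add: val_flat)
qed

lemma parse_val:
  "\<exists>m ys. val w = \<mu> m + syl_prod ys \<and> reduced ys \<and> length ys \<le> length w"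
proof -
  obtain w0 m0 segs where p: "w = w0 @ flat segs" "pinches w0 m0" "segs_pinch segs" "reduced (syllables segs)"
    using parse by blast
  then show ?thesis using length_flat[of segs]
    by (intro exI[of _ m0] exI[of _ "syllables segs"]) (simp add: val_pinches val_flat)
qed

lemma conj_eq: "val u + g = g + val v \<Longrightarrow> val v = - g + val u + g"
  by (simp add: add.assoc)

lemma elliptic_conj_words:
  assumes "pinches u c" "cyc_form v" "val u + val g = val g + val v"
  shows "\<exists>c' es. pinches v c' \<and> chain c es c' \<and> length es \<le> length g"
proof -
  obtain m ys where g: "val g = \<mu> m + syl_prod ys" "reduced ys" "length ys \<le> length g"
    using parse_val by blast
  have V: "val v = - (\<mu> m + syl_prod ys) + \<mu> c + (\<mu> m + syl_prod ys)"
    using conj_eq[OF assms(3)] val_pinches[OF assms(1)] g(1) by simp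
  obtain c' where "val v = \<mu> c'" "chain c (map fst ys) c'"
    using elliptic_conj[OF g(2) V \<tau>_cyc_form[OF assms(2)]] by blast
  then show ?thesis using g(3) pinches_iff by (intro exI[of _ c'] exI[of _ "map fst ys"]) auto
qed

text \<open>
  Rotations bring both words into cyclically reduced form without harm to lengths. The type of the
  first form decides which case holds, since a cyclically reduced product with stable letters is not
  conjugate into the base group.
\<close>
theorem conj_classification:
  assumes "val u + val g = val g + val v"
  obtains (elliptic) r r' c c' es where
      "pinches (rotate r u) c" "pinches (rotate r' v) c'" "chain c es c'"
  | (hyperbolic) r r' segs segs' h where
      "rotate r u = flat segs" "rotate r' v = flat segs'" "segs_pinch segs" "segs_pinch segs'" "segs \<noteq> []"
      "push h (syllables segs) (syllables segs') h"
proof -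
  obtain r where r: "cyc_form (rotate r u)" using cyclic_reduction by blast
  obtain r' where r': "cyc_form (rotate r' v)" using cyclic_reduction by blast
  have "conjw (length g) u v" by (rule conjwI) (use assms in auto)
  then have "conjw (length u + (length g + length v)) (rotate r u) (rotate r' v)"
    by (intro conjw_trans[of _ _ u] conjw_trans[of _ _ v] conjw_rotate conjw_sym[OF conjw_rotate])
  then obtain x where x: "val (rotate r u) + val x = val x + val (rotate r' v)"
    by (auto simp: conjw_def)
  from r show ?thesis unfolding cyc_form_def
  proof (elim disjE exE conjE)
    fix c assume "pinches (rotate r u) c"
    then show ?thesis using elliptic_conj_words[OF _ r' x] elliptic by blast
  next
    fix segs assume s: "segs \<noteq> []" "segs_pinch segs" "cyc_reduced (syllables segs)" "rotate r u = flat segs"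
    obtain m ys where g: "val x = \<mu> m + syl_prod ys" "reduced ys"
      using parse_val by blast
    have V: "val (rotate r' v) = - (\<mu> m + syl_prod ys) + syl_prod (syllables segs) + (\<mu> m + syl_prod ys)"
      using conj_eq[OF x] val_flat[OF s(2)] s(4) g(1) by simp
    obtain k h where "val (rotate r' v) = - \<mu> h + syl_prod (rotate k (syllables segs)) + \<mu> h"
      using hyperbolic_conj[OF g(2) s(3) _ V \<tau>_cyc_form[OF r']] s(1) by auto
    then have h: "syl_prod (syllables (rotate k segs)) + \<mu> h = \<mu> h + val (rotate r' v)"
      by (simp add: syllables_rotate add.assoc)
    obtain j where j: "flat (rotate k segs) = rotate (j + r) u"
      using flat_rotate[of k segs] s(4) by (metis rotate_rotate)
    have reduced: "reduced (syllables (rotate k segs))"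
      using cyc_reduced_rotate[OF s(3), of k] by (simp add: syllables_rotate successively_append_iff)
    from r' show ?thesis unfolding cyc_form_def
    proof (elim disjE exE conjE)
      fix m assume "pinches (rotate r' v) m"
      then have "\<mu> 0 + (syl_prod (syllables (rotate k segs)) + \<mu> h) = \<mu> h + (syl_prod [] + \<mu> m)"
        using h by (simp add: val_pinches)
      from reduced_compare(1)[OF reduced _ this] s(1) show ?thesis by simp
    next
      fix segs' assume s': "segs_pinch segs'" "cyc_reduced (syllables segs')" "rotate r' v = flat segs'"
      have "syl_prod (syllables (rotate k segs)) + \<mu> h = \<mu> h + syl_prod (syllables segs')"
        using h s' by (simp add: val_flat)
      then have "push h (syllables (rotate k segs)) (syllables segs') h"
        using s'(2) reduced by (intro push_complete) (simp_all add: successively_append_iff)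
      then show ?thesis
        using hyperbolic[of "j + r" "rotate k segs" r' segs' h] j s s' by simp
    qed
  qed
qed

end

section \<open>The universal property\<close>

context hnn_words
begin

text \<open>
  Decoding a normal form in another group in which the relations hold turns the action of a letter
  into right multiplication, so words with the same action on normal forms have the same value there.
\<close>
lemma universal_property:
  fixes G (structure) and M :: "'m \<Rightarrow> _" and T :: "'e \<Rightarrow> _"
  assumes "group G"
    and M: "\<And>m. M m \<in> carrier G" "\<And>m m'. M (m + m') = M m \<otimes> M m'"
    and T: "\<And>e. T e \<in> carrier G" "\<And>e. T (ie e) = inv (T e)"
    and MT: "\<And>e h. h \<in> H e \<Longrightarrow> M h \<otimes> T e = T e \<otimes> M (\<phi> e h)"
    and eq: "val u = val v"
  defines "gval \<equiv> \<lambda>w. foldr (\<lambda>l g. (case kind l of Inl m \<Rightarrow> M m | Inr e \<Rightarrow> T e) \<otimes> g) w \<one>"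
  shows "gval u = gval v"
proof -
  interpret group G by fact
  define gl where "gl l = (case kind l of Inl m \<Rightarrow> M m | Inr e \<Rightarrow> T e)" for l
  have gval: "gval [] = \<one>" "\<And>l w. gval (l # w) = gl l \<otimes> gval w"
    by (simp_all add: gval_def gl_def)
  have gl: "gl l \<in> carrier G" for l
    using M T by (auto simp: gl_def split: sum.splits)
  have gc: "gval w \<in> carrier G" for w
    by (induction w) (auto simp: gval gl)
  \<comment> \<open>The value of the list in a state, read from its bottom, and of the whole state.\<close>
  define decs where "decs st = foldr (\<lambda>(e, r) g. g \<otimes> (M r \<otimes> T e)) st \<one>" for st
  have decs: "decs [] = \<one>" "\<And>e r st. decs ((e, r) # st) = decs st \<otimes> (M r \<otimes> T e)"
    by (simp_all add: decs_def)
  have dc: "decs st \<in> carrier G" for st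
    by (induction st) (auto simp: decs M T)
  define dec where "dec s = decs (snd s) \<otimes> M (fst s)" for s :: "'m \<times> ('e \<times> 'm) list"
  have M0: "M 0 = \<one>" using M(2)[of 0 0] M(1)[of 0] by (metis add_0 r_cancel_one')
  have step: "dec (step e s) = dec s \<otimes> T e" if v: "valid (snd s)" for e s
  proof (cases "pops e s")
    case True
    then obtain h r st where s: "s = (h, (ie e, r) # st)" "h \<in> H e"
      by (cases s) (auto simp: pops_def split: list.splits)
    have "dec s \<otimes> T e = decs st \<otimes> M r \<otimes> T (ie e) \<otimes> (M h \<otimes> T e)"
      by (simp add: s dec_def decs m_assoc M T(1) dc)
    also have "\<dots> = decs st \<otimes> M r \<otimes> (T (ie e) \<otimes> T e) \<otimes> M (\<phi> e h)"
      by (simp add: MT[OF s(2)] m_assoc M T(1) dc)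
    also have "\<dots> = dec (step e s)"
      using True v by (simp add: T l_inv step_def pop_letter_def s dec_def M dc m_assoc)
    finally show ?thesis by simp
  next
    case False
    obtain h st where s: "s = (h, st)" by (cases s)
    have "dec (step e s) = decs st \<otimes> M (rep e h) \<otimes> (T e \<otimes> M (\<phi> e (h - rep e h)))"
      using False v by (simp add: step_def push_letter_def s dec_def decs M dc T m_assoc)
    also have "\<dots> = decs st \<otimes> (M (rep e h) \<otimes> M (h - rep e h)) \<otimes> T e"
      by (simp add: m_assoc M(1) T dc flip: MT[OF rep_in'])
    also have "M (rep e h) \<otimes> M (h - rep e h) = M h" by (simp flip: M(2))
    finally show ?thesis by (simp add: dec_def s)
  qed
  have letter: "dec (app (lval l) s) = dec s \<otimes> gl l \<and> valid (snd (app (lval l) s))"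
    if v: "valid (snd s)" for l s
    using v step[OF v]
    by (cases "kind l") (simp_all add: lval_def gl_def app_\<mu> app_t valid_step dec_def M m_assoc dc)
  have dec_c: "dec s \<in> carrier G" for s by (simp add: dec_def dc M)
  have "dec (app (val w) s) = dec s \<otimes> gval w" if "valid (snd s)" for w s
    using that
  proof (induction w arbitrary: s)
    case Nil
    then show ?case by (simp add: app_zero gval dec_c)
  next
    case (Cons l w)
    then show ?case
      using letter[of s l] by (simp add: app_plus gval m_assoc gl gc dec_c)
  qed
  from this[of "(0, [])"] have "dec (app (val w) (0, [])) = gval w" for w
    by (simp add: dec_def decs M0 gc)
  then show ?thesis using eq by metis
qed

end

text \<open>
  An equation \<open>x t = t y\<close> expresses that \<open>t\<close> conjugates \<open>x\<close> to \<open>y\<close>; the case \<open>x = y\<close> is commutation.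
\<close>
lemma (in group) intertwine_nat_pow:
  assumes "x \<in> carrier G" "y \<in> carrier G" "t \<in> carrier G" "x \<otimes> t = t \<otimes> y"
  shows "x [^] (n::nat) \<otimes> t = t \<otimes> y [^] n"
proof (induction n)
  case (Suc n)
  have "x [^] Suc n \<otimes> t = x [^] n \<otimes> t \<otimes> y" using assms by (simp add: m_assoc)
  also have "\<dots> = t \<otimes> y [^] Suc n" using assms by (simp add: Suc m_assoc)
  finally show ?case .
qed (use assms in simp)

lemma (in group) intertwine_inv:
  assumes "x \<in> carrier G" "y \<in> carrier G" "t \<in> carrier G" "x \<otimes> t = t \<otimes> y"
  shows "inv x \<otimes> t = t \<otimes> inv y"
  using assms by (metis inv_closed inv_solve_left inv_solve_right m_assoc m_closed)

lemma (in group) intertwine_int_pow: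
  assumes "x \<in> carrier G" "y \<in> carrier G" "t \<in> carrier G" "x \<otimes> t = t \<otimes> y"
  shows "x [^] (i::int) \<otimes> t = t \<otimes> y [^] i"
proof (cases i rule: int_cases2)
  case (nonneg n)
  then show ?thesis using intertwine_nat_pow[OF assms] by (simp add: int_pow_int)
next
  case (nonpos n)
  then show ?thesis using intertwine_nat_pow[OF assms] intertwine_inv assms
    by (simp add: int_pow_neg int_pow_int)
qed

lemma (in group) commute_int_pow:
  assumes "x \<in> carrier G" "y \<in> carrier G" "x \<otimes> y = y \<otimes> x"
  shows "x [^] (i::int) \<otimes> y [^] (j::int) = y [^] j \<otimes> x [^] i"
  using intertwine_int_pow[of x x "y [^] j"] intertwine_int_pow[of y y x] assms by simp

section \<open>The central extension as a multiple HNN extension\<close>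

text \<open>
  The names \<open>SS\<close>, \<open>ST\<close>, \<open>Sth\<close> stand for \<open>s\<close>, \<open>t\<close>, \<open>\<theta>\<close>; the Boolean marks the letter itself as opposed to
  its inverse. The triple \<open>(i, j, k)\<close> in the base group stands for \<open>a\<^sup>i b\<^sup>j z\<^sup>k\<close>.
\<close>
datatype stab = SS | ST | Sth

fun flip_sign :: "'a \<times> bool \<Rightarrow> 'a \<times> bool" where
  "flip_sign (x, b) = (x, \<not> b)"

abbreviation unit_sign :: "bool \<Rightarrow> int" where
  "unit_sign b \<equiv> (if b then 1 else - 1)"

fun letter_type :: "B_gen \<times> bool \<Rightarrow> int \<times> int \<times> int + stab \<times> bool" where
  "letter_type (Ba, b) = Inl (unit_sign b, 0, 0)"
| "letter_type (Bb, b) = Inl (0, unit_sign b, 0)"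
| "letter_type (Bz, b) = Inl (0, 0, unit_sign b)"
| "letter_type (Bs, b) = Inr (SS, b)"
| "letter_type (Bt, b) = Inr (ST, b)"
| "letter_type (Btheta, b) = Inr (Sth, b)"

fun stab_gen :: "stab \<Rightarrow> B_gen" where
  "stab_gen SS = Bs" | "stab_gen ST = Bt" | "stab_gen Sth = Btheta"

definition stab_letter :: "stab \<times> bool \<Rightarrow> B_gen \<times> bool" where
  "stab_letter e = (stab_gen (fst e), snd e)"

text \<open>
  The power of \<open>z\<close> by which the letter shears its edge group.
\<close>
fun twist :: "stab \<times> bool \<Rightarrow> int" where
  "twist (Sth, b) = unit_sign b"
| "twist _ = 0"

locale snowflake =
  fixes p q :: nat
  assumes q_pos: "0 < q" and q_less_p: "q < p"
begin

text \<open>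
  The generator, modulo \<open>z\<close>, of the edge group of the letter.
\<close>
fun c :: "stab \<times> bool \<Rightarrow> int \<times> int" where
  "c (SS, b) = (if b then (int q, 0) else (int p, 1))"
| "c (ST, b) = (if b then (int q, 0) else (int p, - 1))"
| "c (Sth, b) = (0, 1)"

definition edge_elt :: "stab \<times> bool \<Rightarrow> int \<Rightarrow> int \<Rightarrow> int \<times> int \<times> int" where
  "edge_elt e i k = (i * fst (c e), i * snd (c e), k)"

definition edge_group :: "stab \<times> bool \<Rightarrow> (int \<times> int \<times> int) set" where
  "edge_group e = {edge_elt e i k | i k. True}"

definition edge_index :: "stab \<times> bool \<Rightarrow> int \<times> int \<times> int \<Rightarrow> int" where
  "edge_index e h = (if fst (c e) = 0 then fst (snd h) else fst h div fst (c e))"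

definition edge_iso :: "stab \<times> bool \<Rightarrow> int \<times> int \<times> int \<Rightarrow> int \<times> int \<times> int" where
  "edge_iso e h = edge_elt (flip_sign e) (edge_index e h) (snd (snd h) + twist e * edge_index e h)"

lemma p_pos: "0 < p" using q_pos q_less_p by simp

lemma c_cases:
  "fst (c e) = 0 \<Longrightarrow> snd (c e) = 1"
  by (cases e rule: c.cases) (use q_pos p_pos in \<open>auto split: if_splits\<close>)

lemma edge_index_edge_elt [simp]: "edge_index e (edge_elt e i k) = i"
  using c_cases[of e] by (auto simp: edge_index_def edge_elt_def)

lemma edge_iso_edge_elt [simp]: "edge_iso e (edge_elt e i k) = edge_elt (flip_sign e) i (k + twist e * i)"
  by (simp add: edge_iso_def) (simp add: edge_elt_def)

lemma edge_elt_in [simp]: "edge_elt e i k \<in> edge_group e"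
  by (auto simp: edge_group_def)

lemma edge_elt_add: "edge_elt e i k + edge_elt e i' k' = edge_elt e (i + i') (k + k')"
  by (simp add: edge_elt_def algebra_simps)

lemma edge_elt_minus: "- edge_elt e i k = edge_elt e (- i) (- k)"
  by (simp add: edge_elt_def)

lemma twist_flip: "twist (flip_sign e) = - twist e"
  by (cases e rule: twist.cases) auto

lemma flip_flip [simp]: "flip_sign (flip_sign e) = e"
  by (cases e) simp

sublocale hnn_words edge_group edge_iso flip_sign letter_type stab_letter flip_sign
proof unfold_locales
  fix e :: "stab \<times> bool" and x y :: "int \<times> int \<times> int" and l :: "B_gen \<times> bool"
  show "flip_sign (flip_sign e) = e" by simp
  show "flip_sign e \<noteq> e" by (cases e) simp
  show "0 \<in> edge_group e" using edge_elt_in[of e 0 0] by (simp add: edge_elt_def flip: zero_prod_def)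
  show "x \<in> edge_group e \<Longrightarrow> y \<in> edge_group e \<Longrightarrow> x + y \<in> edge_group e"
    by (clarsimp simp: edge_group_def edge_elt_add) blast
  show "x \<in> edge_group e \<Longrightarrow> - x \<in> edge_group e"
    by (clarsimp simp: edge_group_def edge_elt_minus) blast
  show "x \<in> edge_group e \<Longrightarrow> y \<in> edge_group e \<Longrightarrow> edge_iso e (x + y) = edge_iso e x + edge_iso e y"
    by (auto simp: edge_group_def edge_elt_add) (simp add: algebra_simps)
  show "x \<in> edge_group e \<Longrightarrow> edge_iso e x \<in> edge_group (flip_sign e)"
    by (auto simp: edge_iso_def)
  show "x \<in> edge_group e \<Longrightarrow> edge_iso (flip_sign e) (edge_iso e x) = x"
    by (auto simp: edge_group_def twist_flip)
  show "letter_type l = Inr e \<longleftrightarrow> l = stab_letter e"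
    by (cases l rule: letter_type.cases; cases e; cases "fst e")
       (auto simp: stab_letter_def)
  show "letter_type (flip_sign l) = map_sum uminus flip_sign (letter_type l)"
    by (cases l rule: letter_type.cases) auto
qed

lemma \<mu>_000: "\<mu> (0, 0, 0) = 0"
  using \<mu>_zero by (simp only: zero_prod_def)

lemma \<mu>_diff: "\<mu> (m - m') = \<mu> m - \<mu> m'"
  using \<mu>_add[of m "- m'"] by (simp add: \<mu>_minus)

lemma winv_eq: "winv w = rev (map flip_sign w)"
  by (simp add: winv_def) (metis (no_types, lifting) flip_sign.simps map_eq_conv old.prod.case surj_pair)

lemma val_winv: "val (winv w) = - val w"
  by (simp add: winv_eq val_inverse)

lemma val_wpow_a: "val (wpow (gen Ba) n) = \<mu> (int n, 0, 0)"
  by (induction n) (simp_all add: wpow_def gen_def lval_def flip: zero_prod_def \<mu>_add)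

lemma lval_simps:
  "lval (Ba, b) = \<mu> (unit_sign b, 0, 0)" "lval (Bb, b) = \<mu> (0, unit_sign b, 0)"
  "lval (Bz, b) = \<mu> (0, 0, unit_sign b)" "lval (Bs, b) = t (SS, b)"
  "lval (Bt, b) = t (ST, b)" "lval (Btheta, b) = t (Sth, b)"
  by (simp_all add: lval_def)

lemma t_conj_edge_elt: "- t e + (\<mu> (edge_elt e i k) + t e) = \<mu> (edge_elt (flip_sign e) i (k + twist e * i))"
  using t_conj[OF edge_elt_in[of e i k]] by (simp add: add.assoc)

lemma central: "\<mu> (0, 0, k) + val w = val w + \<mu> (0, 0, k)"
proof (induction w)
  case (Cons l w)
  have "\<mu> (0, 0, k) + lval l = lval l + \<mu> (0, 0, k)"
  proof (cases "letter_type l")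
    case (Inl m)
    then show ?thesis using \<mu>_commute by (simp add: lval_def)
  next
    case (Inr e)
    have "edge_elt f 0 k = (0, 0, k)" for f by (simp add: edge_elt_def)
    moreover have "\<mu> (edge_elt e 0 k) + t e = t e + \<mu> (edge_elt (flip_sign e) 0 k)"
      using \<mu>_t[OF edge_elt_in[of e 0 k]] by simp
    ultimately show ?thesis using Inr by (simp add: lval_def)
  qed
  then have "\<mu> (0, 0, k) + val (l # w) = lval l + (\<mu> (0, 0, k) + val w)"
    by (simp flip: add.assoc)
  then show ?case by (simp add: Cons add.assoc)
qed simp

lemma pres_eq_val: "pres_eq (B_rels p q) u v \<Longrightarrow> val u = val v"
proof (induction rule: pres_eq.induct)
  case (pres_cancel x e)
  show ?case using lval_inv_letter[of "(x, e)"] by simp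
next
  case (pres_rel u v)
  have 1: "- t (Sth, True) + (\<mu> (0, 1, 0) + t (Sth, True)) = \<mu> (0, 1, 1)"
    using t_conj_edge_elt[of "(Sth, True)" 1 0] by (simp add: edge_elt_def)
  have 2: "- t (SS, True) + (\<mu> (int q, 0, 0) + t (SS, True)) = \<mu> (int p, 1, 0)"
    using t_conj_edge_elt[of "(SS, True)" 1 0] by (simp add: edge_elt_def)
  have 3: "- t (ST, True) + (\<mu> (int q, 0, 0) + t (ST, True)) = \<mu> (int p, - 1, 0)"
    using t_conj_edge_elt[of "(ST, True)" 1 0] by (simp add: edge_elt_def)
  show ?case using pres_rel
    unfolding B_rels_def Un_iff insert_iff mem_Collect_eq empty_iff Pair_inject prod.inject
  proof (elim disjE exE conjE)
    fix x assume "u = gen Bz @ gen x" "v = gen x @ gen Bz"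
    then show ?thesis using central[of 1 "gen x"] by (simp add: gen_def lval_simps)
  next
    assume "u = wcomm (gen Bb) (gen Btheta)" "v = gen Bz"
    then show ?thesis
      by (simp add: val_winv wcomm_def gen_def lval_simps 1 flip: \<mu>_minus \<mu>_add)
  next
    assume "u = wcomm (gen Ba) (gen Bb)" "v = []"
    then show ?thesis
      by (simp add: val_winv wcomm_def gen_def lval_simps \<mu>_000 flip: \<mu>_minus \<mu>_add)
  next
    assume "u = winv (gen Bs) @ wpow (gen Ba) q @ gen Bs" "v = wpow (gen Ba) p @ gen Bb"
    then show ?thesis
      by (simp add: val_winv val_wpow_a) (simp add: gen_def lval_simps 2 flip: \<mu>_add)
  next
    assume "u = winv (gen Bt) @ wpow (gen Ba) q @ gen Bt" "v = wpow (gen Ba) p @ winv (gen Bb)"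
    then show ?thesis
      by (simp add: val_winv val_wpow_a) (simp add: gen_def lval_simps 3 flip: \<mu>_diff)
  qed simp_all
next
  case (pres_app u u' v v')
  then show ?case by (simp only: val_simps)
next
  case (pres_trans u v w)
  then show ?case by (simp only:)
next
  case (pres_sym u v)
  then show ?case by (simp only:)
next
  case (pres_refl u)
  show ?case by (rule refl)
qed

end

section \<open>Normal forms decide equality in the presented group\<close>

lemma (in group) intertwine_swap:
  assumes "x \<in> carrier G" "y \<in> carrier G" "t \<in> carrier G" "x \<otimes> t = t \<otimes> y"
  shows "y \<otimes> inv t = inv t \<otimes> x"
proof -
  have "y \<otimes> inv t = (inv t \<otimes> (t \<otimes> y)) \<otimes> inv t" using assms(1-3) by (simp flip: m_assoc)
  also have "\<dots> = (inv t \<otimes> (x \<otimes> t)) \<otimes> inv t" by (simp only: assms(4))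
  also have "\<dots> = inv t \<otimes> x" using assms(1-3) by (simp add: m_assoc)
  finally show ?thesis .
qed

context snowflake
begin

text \<open>
  Completeness, by the universal property: in the presented group the elements \<open>A\<^sup>i B\<^sup>j Z\<^sup>k\<close> form an image
  of the base group, and the relations of the edge groups follow from those of their generators,
  the ones for inverse letters by inverting them.
\<close>
lemma val_pres_eq:
  assumes "val u = val v"
  shows "pres_eq (B_rels p q) u v"
proof -
  let ?R = "B_rels p q"
  let ?G = "B_tilde p q"
  interpret group ?G by (rule group_presented_group)
  define g where "g x = pres_class ?R (gen x)" for x
  have gc [simp]: "g x \<in> carrier ?G" for x by (simp add: g_def carrier_presented_group)
  have rel: "pres_class ?R u = pres_class ?R v" if "(u, v) \<in> ?R" for u v
    unfolding pres_class_eq_iff using that by (rule pres_rel)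
  note hom = mult_presented_group[of ?R, symmetric] inv_presented_group[of ?R, symmetric]
  have pow: "pres_class ?R (wpow (gen x) n) = g x [^]\<^bsub>?G\<^esub> n" for x n
  proof (induction n)
    case 0
    then show ?case by (simp add: wpow_def flip: one_presented_group)
  next
    case (Suc n)
    have "pres_class ?R (wpow (gen x) (Suc n)) = g x \<otimes>\<^bsub>?G\<^esub> pres_class ?R (wpow (gen x) n)"
      by (simp add: wpow_def g_def hom)
    then show ?case using nat_pow_Suc2[OF gc, of x n] by (simp only: Suc)
  qed
  note defs = wcomm_def hom pow g_def[symmetric] one_presented_group[symmetric]
  have rel1: "(wcomm (gen Bb) (gen Btheta), gen Bz) \<in> ?R"
    and rel2: "(wcomm (gen Ba) (gen Bb), []) \<in> ?R"
    and rel3: "(winv (gen Bs) @ wpow (gen Ba) q @ gen Bs, wpow (gen Ba) p @ gen Bb) \<in> ?R"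
    and rel4: "(winv (gen Bt) @ wpow (gen Ba) q @ gen Bt, wpow (gen Ba) p @ winv (gen Bb)) \<in> ?R"
    by (simp_all add: B_rels_def)
  let ?A = "g Ba" and ?B = "g Bb" and ?Z = "g Bz" and ?S = "g Bs" and ?T = "g Bt" and ?Th = "g Btheta"
  have Z: "?Z \<otimes>\<^bsub>?G\<^esub> g x = g x \<otimes>\<^bsub>?G\<^esub> ?Z" for x
  proof (cases "x = Bz")
    case False
    then have "(gen Bz @ gen x, gen x @ gen Bz) \<in> ?R" by (auto simp: B_rels_def)
    from rel[OF this] show ?thesis by (simp add: defs)
  qed simp
  have "inv\<^bsub>?G\<^esub> ?B \<otimes>\<^bsub>?G\<^esub> (inv\<^bsub>?G\<^esub> ?Th \<otimes>\<^bsub>?G\<^esub> (?B \<otimes>\<^bsub>?G\<^esub> ?Th)) = ?Z"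
    using rel[OF rel1] by (simp add: defs)
  then have BTh: "?B \<otimes>\<^bsub>?G\<^esub> ?Th = ?Th \<otimes>\<^bsub>?G\<^esub> (?B \<otimes>\<^bsub>?G\<^esub> ?Z)"
    by (metis gc inv_closed inv_solve_left m_closed)
  have "inv\<^bsub>?G\<^esub> ?A \<otimes>\<^bsub>?G\<^esub> (inv\<^bsub>?G\<^esub> ?B \<otimes>\<^bsub>?G\<^esub> (?A \<otimes>\<^bsub>?G\<^esub> ?B)) = \<one>\<^bsub>?G\<^esub>"
    using rel[OF rel2] by (simp add: defs)
  then have AB: "?A \<otimes>\<^bsub>?G\<^esub> ?B = ?B \<otimes>\<^bsub>?G\<^esub> ?A"
    by (metis gc inv_closed inv_solve_left m_closed r_one one_closed)
  have "inv\<^bsub>?G\<^esub> ?S \<otimes>\<^bsub>?G\<^esub> (?A [^]\<^bsub>?G\<^esub> q \<otimes>\<^bsub>?G\<^esub> ?S) = ?A [^]\<^bsub>?G\<^esub> p \<otimes>\<^bsub>?G\<^esub> ?B"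
    using rel[OF rel3] by (simp add: defs)
  then have AS: "?A [^]\<^bsub>?G\<^esub> q \<otimes>\<^bsub>?G\<^esub> ?S = ?S \<otimes>\<^bsub>?G\<^esub> (?A [^]\<^bsub>?G\<^esub> p \<otimes>\<^bsub>?G\<^esub> ?B)"
    by (metis gc inv_closed inv_solve_left m_closed nat_pow_closed)
  have "inv\<^bsub>?G\<^esub> ?T \<otimes>\<^bsub>?G\<^esub> (?A [^]\<^bsub>?G\<^esub> q \<otimes>\<^bsub>?G\<^esub> ?T) = ?A [^]\<^bsub>?G\<^esub> p \<otimes>\<^bsub>?G\<^esub> inv\<^bsub>?G\<^esub> ?B"
    using rel[OF rel4] by (simp add: defs)
  then have AT: "?A [^]\<^bsub>?G\<^esub> q \<otimes>\<^bsub>?G\<^esub> ?T = ?T \<otimes>\<^bsub>?G\<^esub> (?A [^]\<^bsub>?G\<^esub> p \<otimes>\<^bsub>?G\<^esub> inv\<^bsub>?G\<^esub> ?B)"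
    by (metis gc inv_closed inv_solve_left m_closed nat_pow_closed)
  define M where "M = (\<lambda>(i::int, j::int, k::int).
    (?A [^]\<^bsub>?G\<^esub> i \<otimes>\<^bsub>?G\<^esub> ?B [^]\<^bsub>?G\<^esub> j) \<otimes>\<^bsub>?G\<^esub> ?Z [^]\<^bsub>?G\<^esub> k)"
  define T where "T = (\<lambda>(x, b). if b then g (stab_gen x) else inv\<^bsub>?G\<^esub> g (stab_gen x))"
  have Mc [simp]: "M m \<in> carrier ?G" for m by (auto simp: M_def split: prod.splits)
  have Tc [simp]: "T e \<in> carrier ?G" for e by (auto simp: T_def split: prod.splits)
  note swapAB = commute_int_pow[OF gc gc AB]
  note swapZ = commute_int_pow[OF gc gc Z]
  have Madd: "M (m + m') = M m \<otimes>\<^bsub>?G\<^esub> M m'" for m m'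
  proof -
    obtain i j k i' j' k' where m: "m = (i, j, k)" "m' = (i', j', k')" by (cases m, cases m')
    let ?a = "?A [^]\<^bsub>?G\<^esub> i" and ?a' = "?A [^]\<^bsub>?G\<^esub> i'" and ?b = "?B [^]\<^bsub>?G\<^esub> j"
      and ?b' = "?B [^]\<^bsub>?G\<^esub> j'" and ?z = "?Z [^]\<^bsub>?G\<^esub> k" and ?z' = "?Z [^]\<^bsub>?G\<^esub> k'"
    have "M m \<otimes>\<^bsub>?G\<^esub> M m' = ?a \<otimes>\<^bsub>?G\<^esub> (?b \<otimes>\<^bsub>?G\<^esub> ((?z \<otimes>\<^bsub>?G\<^esub> ?a') \<otimes>\<^bsub>?G\<^esub> (?b' \<otimes>\<^bsub>?G\<^esub> ?z')))"
      by (simp add: m M_def m_assoc)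
    also have "\<dots> = ?a \<otimes>\<^bsub>?G\<^esub> ((?b \<otimes>\<^bsub>?G\<^esub> ?a') \<otimes>\<^bsub>?G\<^esub> ((?z \<otimes>\<^bsub>?G\<^esub> ?b') \<otimes>\<^bsub>?G\<^esub> ?z'))"
      by (subst swapZ) (simp add: m_assoc)
    also have "\<dots> = (?a \<otimes>\<^bsub>?G\<^esub> ?a') \<otimes>\<^bsub>?G\<^esub> (?b \<otimes>\<^bsub>?G\<^esub> ?b') \<otimes>\<^bsub>?G\<^esub> (?z \<otimes>\<^bsub>?G\<^esub> ?z')"
      by (subst swapZ, subst swapAB[symmetric]) (simp add: m_assoc)
    also have "\<dots> = M (m + m')" by (simp add: m M_def int_pow_mult)
    finally show ?thesis by simp
  qed
  have M0: "M 0 = \<one>\<^bsub>?G\<^esub>" by (simp add: M_def zero_prod_def)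
  have Mneg: "M (- m) = inv\<^bsub>?G\<^esub> (M m)" for m
    using Madd[of "- m" m] by (intro inv_equality[symmetric]) (simp_all add: M0)
  have gZT: "?Z [^]\<^bsub>?G\<^esub> k \<otimes>\<^bsub>?G\<^esub> T e = T e \<otimes>\<^bsub>?G\<^esub> ?Z [^]\<^bsub>?G\<^esub> k" for k :: int and e
  proof -
    obtain x b where e: "e = (x, b)" by (cases e)
    show ?thesis
      using swapZ[of k "stab_gen x" "unit_sign b"] by (cases b) (simp_all add: e T_def int_pow_neg)
  qed
  have Mpow: "M (i * x, i * y, i * z) = M (x, y, z) [^]\<^bsub>?G\<^esub> i" for i x y z
  proof -
    have nat: "M (int n * x, int n * y, int n * z) = M (x, y, z) [^]\<^bsub>?G\<^esub> n" for n
    proof (induction n)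
      case (Suc n)
      have "M (int (Suc n) * x, int (Suc n) * y, int (Suc n) * z) = M ((int n * x, int n * y, int n * z) + (x, y, z))"
        by (simp add: algebra_simps)
      also have "\<dots> = M (x, y, z) [^]\<^bsub>?G\<^esub> Suc n" by (simp only: Madd Suc nat_pow_Suc)
      finally show ?case .
    qed (use M0 in \<open>simp add: zero_prod_def\<close>)
    show ?thesis
    proof (cases i rule: int_cases2)
      case (nonpos n)
      have "M (i * x, i * y, i * z) = M (- (int n * x, int n * y, int n * z))" by (simp add: nonpos)
      also have "\<dots> = inv\<^bsub>?G\<^esub> (M (x, y, z) [^]\<^bsub>?G\<^esub> n)" by (simp only: Mneg nat)
      also have "\<dots> = M (x, y, z) [^]\<^bsub>?G\<^esub> i" by (simp add: nonpos int_pow_neg int_pow_int)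
      finally show ?thesis .
    qed (simp add: nat int_pow_int)
  qed
  define gcm where "gcm e k = (fst (c e), snd (c e), k)" for e and k :: int
  have base: "M (gcm (x, True) 0) \<otimes>\<^bsub>?G\<^esub> T (x, True)
      = T (x, True) \<otimes>\<^bsub>?G\<^esub> M (gcm (x, False) (twist (x, True)))" for x
    using BTh AS AT by (cases x) (simp_all add: gcm_def M_def T_def int_pow_int int_pow_neg)
  have MT1: "M (gcm e 0) \<otimes>\<^bsub>?G\<^esub> T e = T e \<otimes>\<^bsub>?G\<^esub> M (gcm (flip_sign e) (twist e))" for e
  proof -
    obtain x b where e: "e = (x, b)" by (cases e)
    show ?thesis
    proof (cases b)
      case True
      then show ?thesis using base by (simp add: e)
    next
      case False
      let ?w = "twist (x, True)"
      have T': "T e = inv\<^bsub>?G\<^esub> T (x, True)" by (simp add: T_def e False)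
      have 1: "M (gcm f (k + k')) = M (gcm f k) \<otimes>\<^bsub>?G\<^esub> ?Z [^]\<^bsub>?G\<^esub> k'" for f k k'
        by (simp add: gcm_def M_def m_assoc int_pow_mult)
      have "M (gcm e ?w) \<otimes>\<^bsub>?G\<^esub> T e = T e \<otimes>\<^bsub>?G\<^esub> M (gcm (x, True) 0)"
        using intertwine_swap[OF Mc Mc Tc base[of x]] unfolding T' by (simp only: e False)
      then have "M (gcm e ?w) \<otimes>\<^bsub>?G\<^esub> (T e \<otimes>\<^bsub>?G\<^esub> ?Z [^]\<^bsub>?G\<^esub> (- ?w))
          = T e \<otimes>\<^bsub>?G\<^esub> (M (gcm (x, True) 0) \<otimes>\<^bsub>?G\<^esub> ?Z [^]\<^bsub>?G\<^esub> (- ?w))"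
        by (simp flip: m_assoc)
      then have "(M (gcm e ?w) \<otimes>\<^bsub>?G\<^esub> ?Z [^]\<^bsub>?G\<^esub> (- ?w)) \<otimes>\<^bsub>?G\<^esub> T e
          = T e \<otimes>\<^bsub>?G\<^esub> (M (gcm (x, True) 0) \<otimes>\<^bsub>?G\<^esub> ?Z [^]\<^bsub>?G\<^esub> (- ?w))"
        by (simp add: m_assoc gZT)
      then show ?thesis
        using twist_flip[of "(x, True)"] by (simp add: e False flip: 1)
    qed
  qed
  have MT: "M h \<otimes>\<^bsub>?G\<^esub> T e = T e \<otimes>\<^bsub>?G\<^esub> M (edge_iso e h)" if "h \<in> edge_group e" for h e
  proof -
    from that obtain i k where h: "h = edge_elt e i k" by (auto simp: edge_group_def)
    have Mz: "M (0, 0, k) = ?Z [^]\<^bsub>?G\<^esub> k" by (simp add: M_def)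
    have split: "M (edge_elt f i (k + i * w)) = M (gcm f w) [^]\<^bsub>?G\<^esub> i \<otimes>\<^bsub>?G\<^esub> ?Z [^]\<^bsub>?G\<^esub> k" for f w
    proof -
      have "M (edge_elt f i (k + i * w)) = M ((i * fst (c f), i * snd (c f), i * w) + (0, 0, k))"
        by (simp add: edge_elt_def add.commute)
      also have "\<dots> = M (i * fst (c f), i * snd (c f), i * w) \<otimes>\<^bsub>?G\<^esub> M (0, 0, k)" by (rule Madd)
      finally show ?thesis by (simp only: Mpow Mz gcm_def)
    qed
    have "M h = M (gcm e 0) [^]\<^bsub>?G\<^esub> i \<otimes>\<^bsub>?G\<^esub> ?Z [^]\<^bsub>?G\<^esub> k"
      using split[of e 0] by (simp only: h mult_zero_right add_0_right)
    moreover have "M (edge_iso e h) = M (gcm (flip_sign e) (twist e)) [^]\<^bsub>?G\<^esub> i \<otimes>\<^bsub>?G\<^esub> ?Z [^]\<^bsub>?G\<^esub> k"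
      using split[of "flip_sign e" "twist e"] by (simp only: h edge_iso_edge_elt mult.commute[of "twist e"])
    moreover have "M (gcm e 0) [^]\<^bsub>?G\<^esub> i \<otimes>\<^bsub>?G\<^esub> T e = T e \<otimes>\<^bsub>?G\<^esub> M (gcm (flip_sign e) (twist e)) [^]\<^bsub>?G\<^esub> i"
      by (rule intertwine_int_pow[OF Mc Mc Tc MT1])
    ultimately show ?thesis by (simp add: m_assoc gZT) (simp flip: m_assoc)
  qed
  have Tinv: "T (flip_sign e) = inv\<^bsub>?G\<^esub> T e" for e
    by (cases e) (simp add: T_def)
  define gval where "gval = (\<lambda>w. foldr (\<lambda>l h. (case letter_type l of Inl m \<Rightarrow> M m | Inr e \<Rightarrow> T e) \<otimes>\<^bsub>?G\<^esub> h) w \<one>\<^bsub>?G\<^esub>)"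
  have "gval u = gval v"
    using universal_property[of ?G M T u v] group_axioms Mc Madd Tc Tinv MT assms
    unfolding gval_def by blast
  moreover have "gval w = pres_class ?R w" for w
  proof -
    have "(case letter_type (x, b) of Inl m \<Rightarrow> M m | Inr e \<Rightarrow> T e)
        = (if b then pres_gen ?R x else inv\<^bsub>?G\<^esub> pres_gen ?R x)" for x b
      by (cases x; cases b) (simp_all add: M_def T_def pres_gen_def g_def[symmetric] int_pow_neg)
    then have "gval w = word_val ?G (pres_gen ?R) w"
      unfolding gval_def word_val_def by (intro foldr_cong) auto
    then show ?thesis by (simp add: word_val_presented_group)
  qed
  ultimately show ?thesis by (simp add: pres_class_eq_iff)
qed

lemma pres_eq_iff_val: "pres_eq (B_rels p q) u v \<longleftrightarrow> val u = val v"
  using pres_eq_val val_pres_eq by blast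

end

section \<open>Distortion of the base group\<close>

lemma powr_superadd:
  fixes x y a :: real
  assumes "0 \<le> x" "0 \<le> y" "1 \<le> a"
  shows "x powr a + y powr a \<le> (x + y) powr a"
proof -
  have split: "z powr a = z * z powr (a - 1)" if "0 \<le> z" for z :: real
    using that powr_add[of z 1 "a - 1"] by (cases "z = 0") auto
  have "x powr a + y powr a \<le> x * (x + y) powr (a - 1) + y * (x + y) powr (a - 1)"
    unfolding split[OF assms(1)] split[OF assms(2)]
    using assms by (intro add_mono mult_left_mono powr_mono2) auto
  also have "\<dots> = (x + y) powr a" using assms by (simp add: split[of "x + y"] algebra_simps)
  finally show ?thesis .
qed

context snowflake
begin

definition \<alpha> :: real where
  "\<alpha> = log 2 (2 * real p / real q)"

lemma two_powr_\<alpha>: "2 powr \<alpha> = 2 * real p / real q"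
  unfolding \<alpha>_def using p_pos q_pos by (intro powr_log_cancel) auto

lemma \<alpha>_ge_1: "1 \<le> \<alpha>"
proof -
  have "log 2 2 \<le> \<alpha>" unfolding \<alpha>_def
    using q_pos q_less_p by (subst log_le_cancel_iff) (auto simp: field_simps)
  then show ?thesis by simp
qed

lemma double_powr_\<alpha>: "0 \<le> x \<Longrightarrow> real q * (2 * x) powr \<alpha> = 2 * real p * x powr \<alpha>"
  using q_pos by (simp add: powr_mult two_powr_\<alpha>)

text \<open>
  An element \<open>(i, j)\<close> is a sum of contributions \<open>P\<close> along \<open>a\<^sup>p b\<close>, \<open>Q\<close> along \<open>a\<^sup>p b\<^sup>-\<^sup>1\<close>, \<open>A\<close> along \<open>a\<close> and \<open>B\<close>
  along \<open>b\<close>, each bounded in terms of its share of the length \<open>n\<close>. The bounds along \<open>a\<close> and \<open>b\<close> are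
  better by the factor \<open>q / p\<close> than the general ones, when \<open>(i, j)\<close> is measured by
  \<open>max (\<bar>i\<bar> / p) \<bar>j\<bar>\<close>; this is what allows a pinch by \<open>s\<close> or \<open>t\<close> to lose the factor \<open>p / q\<close>.
\<close>
definition split_bound :: "real \<Rightarrow> int \<Rightarrow> int \<Rightarrow> bool" where
  "split_bound n i j \<longleftrightarrow> (\<exists>P Q A B x\<^sub>1 x\<^sub>2 x\<^sub>3 x\<^sub>4 :: real.
     0 \<le> x\<^sub>1 \<and> 0 \<le> x\<^sub>2 \<and> 0 \<le> x\<^sub>3 \<and> 0 \<le> x\<^sub>4 \<and> x\<^sub>1 + x\<^sub>2 + x\<^sub>3 + x\<^sub>4 \<le> n \<and>
     \<bar>P\<bar> \<le> real p * x\<^sub>1 powr \<alpha> \<and> \<bar>Q\<bar> \<le> real p * x\<^sub>2 powr \<alpha> \<and> \<bar>A\<bar> \<le> real p * real q * x\<^sub>3 powr \<alpha> \<and> \<bar>B\<bar> \<le> real q * x\<^sub>4 powr \<alpha> \<and>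
     real_of_int i = real p * (P + Q) + A \<and> real_of_int j = P - Q + B)"

lemma split_boundI:
  assumes "0 \<le> x\<^sub>1" "0 \<le> x\<^sub>2" "0 \<le> x\<^sub>3" "0 \<le> x\<^sub>4" "x\<^sub>1 + x\<^sub>2 + x\<^sub>3 + x\<^sub>4 \<le> n"
     "\<bar>P\<bar> \<le> real p * x\<^sub>1 powr \<alpha>" "\<bar>Q\<bar> \<le> real p * x\<^sub>2 powr \<alpha>" "\<bar>A\<bar> \<le> real p * real q * x\<^sub>3 powr \<alpha>" "\<bar>B\<bar> \<le> real q * x\<^sub>4 powr \<alpha>"
     "real_of_int i = real p * (P + Q) + A" "real_of_int j = P - Q + B"
  shows "split_bound n i j"
  unfolding split_bound_def
  by (rule exI[of _ P], rule exI[of _ Q], rule exI[of _ A], rule exI[of _ B],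
      rule exI[of _ x\<^sub>1], rule exI[of _ x\<^sub>2], rule exI[of _ x\<^sub>3], rule exI[of _ x\<^sub>4],
      intro conjI; fact assms)

lemma split_boundE:
  assumes "split_bound n i j"
  obtains P Q A B x\<^sub>1 x\<^sub>2 x\<^sub>3 x\<^sub>4 :: real where "0 \<le> x\<^sub>1" "0 \<le> x\<^sub>2" "0 \<le> x\<^sub>3" "0 \<le> x\<^sub>4" "x\<^sub>1 + x\<^sub>2 + x\<^sub>3 + x\<^sub>4 \<le> n"
     "\<bar>P\<bar> \<le> real p * x\<^sub>1 powr \<alpha>" "\<bar>Q\<bar> \<le> real p * x\<^sub>2 powr \<alpha>" "\<bar>A\<bar> \<le> real p * real q * x\<^sub>3 powr \<alpha>" "\<bar>B\<bar> \<le> real q * x\<^sub>4 powr \<alpha>"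
     "real_of_int i = real p * (P + Q) + A" "real_of_int j = P - Q + B"
  using assms unfolding split_bound_def by (elim exE conjE) (rule that; assumption)

lemma split_bound_mono: "split_bound n i j \<Longrightarrow> n \<le> n' \<Longrightarrow> split_bound n' i j"
  unfolding split_bound_def by (meson order_trans)

lemma split_bound_add:
  assumes "split_bound n i j" "split_bound n' i' j'"
  shows "split_bound (n + n') (i + i') (j + j')"
proof -
  from assms(1) obtain P Q A B x\<^sub>1 x\<^sub>2 x\<^sub>3 x\<^sub>4 where 1:
    "0 \<le> x\<^sub>1" "0 \<le> x\<^sub>2" "0 \<le> x\<^sub>3" "0 \<le> x\<^sub>4" "x\<^sub>1 + x\<^sub>2 + x\<^sub>3 + x\<^sub>4 \<le> n"
     "\<bar>P\<bar> \<le> real p * x\<^sub>1 powr \<alpha>" "\<bar>Q\<bar> \<le> real p * x\<^sub>2 powr \<alpha>" "\<bar>A\<bar> \<le> real p * real q * x\<^sub>3 powr \<alpha>" "\<bar>B\<bar> \<le> real q * x\<^sub>4 powr \<alpha>"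
     "real_of_int i = real p * (P + Q) + A" "real_of_int j = P - Q + B" by (rule split_boundE)
  from assms(2) obtain P' Q' A' B' y\<^sub>1 y\<^sub>2 y\<^sub>3 y\<^sub>4 where 2:
    "0 \<le> y\<^sub>1" "0 \<le> y\<^sub>2" "0 \<le> y\<^sub>3" "0 \<le> y\<^sub>4" "y\<^sub>1 + y\<^sub>2 + y\<^sub>3 + y\<^sub>4 \<le> n'"
     "\<bar>P'\<bar> \<le> real p * y\<^sub>1 powr \<alpha>" "\<bar>Q'\<bar> \<le> real p * y\<^sub>2 powr \<alpha>" "\<bar>A'\<bar> \<le> real p * real q * y\<^sub>3 powr \<alpha>" "\<bar>B'\<bar> \<le> real q * y\<^sub>4 powr \<alpha>"
     "real_of_int i' = real p * (P' + Q') + A'" "real_of_int j' = P' - Q' + B'" by (rule split_boundE)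
  have sup: "\<bar>u + v\<bar> \<le> C * (x + y) powr \<alpha>"
    if "\<bar>u\<bar> \<le> C * x powr \<alpha>" "\<bar>v\<bar> \<le> C * y powr \<alpha>" "0 \<le> x" "0 \<le> y" "0 \<le> C" for u v x y C :: real
  proof -
    have "C * (x powr \<alpha> + y powr \<alpha>) \<le> C * (x + y) powr \<alpha>"
      using that powr_superadd[OF _ _ \<alpha>_ge_1] by (intro mult_left_mono) auto
    then show ?thesis using that(1,2) by (simp add: distrib_left)
  qed
  show ?thesis
  proof (rule split_boundI)
    show "x\<^sub>1 + y\<^sub>1 + (x\<^sub>2 + y\<^sub>2) + (x\<^sub>3 + y\<^sub>3) + (x\<^sub>4 + y\<^sub>4) \<le> n + n'" using 1(5) 2(5) by simp
    show "\<bar>P + P'\<bar> \<le> real p * (x\<^sub>1 + y\<^sub>1) powr \<alpha>" using 1 2 by (intro sup) auto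
    show "\<bar>Q + Q'\<bar> \<le> real p * (x\<^sub>2 + y\<^sub>2) powr \<alpha>" using 1 2 by (intro sup) auto
    show "\<bar>A + A'\<bar> \<le> real p * real q * (x\<^sub>3 + y\<^sub>3) powr \<alpha>" using 1 2 by (intro sup) auto
    show "\<bar>B + B'\<bar> \<le> real q * (x\<^sub>4 + y\<^sub>4) powr \<alpha>" using 1 2 by (intro sup) auto
  qed (use 1 2 in \<open>auto simp: algebra_simps\<close>)
qed

lemma powr_\<alpha>_sum3:
  assumes "0 \<le> x" "0 \<le> y" "0 \<le> z" "x + y + z \<le> n"
  shows "x powr \<alpha> + y powr \<alpha> + z powr \<alpha> \<le> n powr \<alpha>"
proof -
  have "x powr \<alpha> + y powr \<alpha> + z powr \<alpha> \<le> (x + y) powr \<alpha> + z powr \<alpha>"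
    using powr_superadd[OF _ _ \<alpha>_ge_1] assms by simp
  also have "\<dots> \<le> (x + y + z) powr \<alpha>" using assms by (intro powr_superadd \<alpha>_ge_1) auto
  also have "\<dots> \<le> n powr \<alpha>" using assms \<alpha>_ge_1 by (intro powr_mono2) auto
  finally show ?thesis .
qed

text \<open>
  On the axis \<open>j = 0\<close> the contributions \<open>P\<close> and \<open>Q\<close> balance up to \<open>B\<close>, so both are controlled by the
  shorter one. For the minimum \<open>x\<close> of the two lengths, \<open>2 x\<^sup>\<alpha> = (q / p) (2 x)\<^sup>\<alpha>\<close> is the gain of the
  factor \<open>q / p\<close>, and \<open>2 x\<close> still fits into the length.
\<close>
lemma split_bound_a_axis:
  assumes "split_bound n i 0"
  shows "\<bar>real_of_int i\<bar> \<le> real p * real q * n powr \<alpha>"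
proof -
  from assms obtain P Q A B x\<^sub>1 x\<^sub>2 x\<^sub>3 x\<^sub>4 where 1:
    "0 \<le> x\<^sub>1" "0 \<le> x\<^sub>2" "0 \<le> x\<^sub>3" "0 \<le> x\<^sub>4" "x\<^sub>1 + x\<^sub>2 + x\<^sub>3 + x\<^sub>4 \<le> n"
     "\<bar>P\<bar> \<le> real p * x\<^sub>1 powr \<alpha>" "\<bar>Q\<bar> \<le> real p * x\<^sub>2 powr \<alpha>" "\<bar>A\<bar> \<le> real p * real q * x\<^sub>3 powr \<alpha>" "\<bar>B\<bar> \<le> real q * x\<^sub>4 powr \<alpha>"
     "real_of_int i = real p * (P + Q) + A" "real_of_int 0 = P - Q + B" by (rule split_boundE)
  define x where "x = min x\<^sub>1 x\<^sub>2"
  \<comment> \<open>\<open>P + Q\<close> is \<open>2P + B\<close> and also \<open>2Q - B\<close>; the shorter of the two pieces gives the bound.\<close>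
  have "\<bar>P + Q\<bar> \<le> 2 * real p * x powr \<alpha> + real q * x\<^sub>4 powr \<alpha>"
    using 1(6,7,9,11) by (auto simp: x_def min_def)
  also have "\<dots> = real q * ((2 * x) powr \<alpha> + x\<^sub>4 powr \<alpha>)"
    using double_powr_\<alpha>[of x] 1(1,2) by (simp add: x_def algebra_simps)
  finally have "real p * \<bar>P + Q\<bar> \<le> real p * (real q * ((2 * x) powr \<alpha> + x\<^sub>4 powr \<alpha>))" by (intro mult_left_mono) auto
  moreover have "\<bar>real_of_int i\<bar> \<le> real p * \<bar>P + Q\<bar> + \<bar>A\<bar>"
    using abs_triangle_ineq[of "real p * (P + Q)" A] by (simp add: 1(10) abs_mult)
  ultimately have "\<bar>real_of_int i\<bar> \<le> real p * (real q * ((2 * x) powr \<alpha> + x\<^sub>4 powr \<alpha>)) + real p * real q * x\<^sub>3 powr \<alpha>"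
    using 1(8) by linarith
  also have "\<dots> = real p * real q * ((2 * x) powr \<alpha> + x\<^sub>4 powr \<alpha> + x\<^sub>3 powr \<alpha>)"
    by (simp add: algebra_simps)
  also have "\<dots> \<le> real p * real q * n powr \<alpha>"
    using 1(1-5) by (intro mult_left_mono powr_\<alpha>_sum3) (auto simp: x_def)
  finally show ?thesis .
qed

text \<open>
  The same balance as on the other axis, with the sum and the difference of \<open>P\<close> and \<open>Q\<close> exchanged.
\<close>
lemma split_bound_b_axis:
  assumes "split_bound n 0 j"
  shows "\<bar>real_of_int j\<bar> \<le> real q * n powr \<alpha>"
proof -
  from assms obtain P Q A B x\<^sub>1 x\<^sub>2 x\<^sub>3 x\<^sub>4 where 1:
    "0 \<le> x\<^sub>1" "0 \<le> x\<^sub>2" "0 \<le> x\<^sub>3" "0 \<le> x\<^sub>4" "x\<^sub>1 + x\<^sub>2 + x\<^sub>3 + x\<^sub>4 \<le> n"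
     "\<bar>P\<bar> \<le> real p * x\<^sub>1 powr \<alpha>" "\<bar>Q\<bar> \<le> real p * x\<^sub>2 powr \<alpha>" "\<bar>A\<bar> \<le> real p * real q * x\<^sub>3 powr \<alpha>" "\<bar>B\<bar> \<le> real q * x\<^sub>4 powr \<alpha>"
     "real_of_int 0 = real p * (P + Q) + A" "real_of_int j = P - Q + B" by (rule split_boundE)
  define x where "x = min x\<^sub>1 x\<^sub>2"
  have "real p * (P + Q) = - A" using 1(10) by simp
  then have "real p * \<bar>P + Q\<bar> = \<bar>A\<bar>" by (metis abs_minus_cancel abs_mult abs_of_nat)
  then have "real p * \<bar>P + Q\<bar> \<le> real p * (real q * x\<^sub>3 powr \<alpha>)" using 1(8) by (simp add: mult.assoc)
  then have PQ: "\<bar>P + Q\<bar> \<le> real q * x\<^sub>3 powr \<alpha>" using p_pos by simp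
  have "\<bar>P - Q\<bar> \<le> 2 * real p * x powr \<alpha> + real q * x\<^sub>3 powr \<alpha>"
    using 1(6,7) PQ by (auto simp: x_def min_def)
  also have "\<dots> = real q * ((2 * x) powr \<alpha> + x\<^sub>3 powr \<alpha>)"
    using double_powr_\<alpha>[of x] 1(1,2) by (simp add: x_def algebra_simps)
  finally have "\<bar>real_of_int j\<bar> \<le> real q * ((2 * x) powr \<alpha> + x\<^sub>3 powr \<alpha> + x\<^sub>4 powr \<alpha>)"
    using 1(9) abs_triangle_ineq[of "P - Q" B] by (simp add: 1(11) algebra_simps)
  also have "\<dots> \<le> real q * n powr \<alpha>"
    using 1(1-5) by (intro mult_left_mono powr_\<alpha>_sum3) (auto simp: x_def)
  finally show ?thesis .
qed

lemma split_bound_general: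
  assumes "split_bound n i j"
  shows "\<bar>real_of_int i\<bar> \<le> real p * real p * n powr \<alpha>" "\<bar>real_of_int j\<bar> \<le> real p * n powr \<alpha>"
proof -
  from assms obtain P Q A B x\<^sub>1 x\<^sub>2 x\<^sub>3 x\<^sub>4 where 1:
    "0 \<le> x\<^sub>1" "0 \<le> x\<^sub>2" "0 \<le> x\<^sub>3" "0 \<le> x\<^sub>4" "x\<^sub>1 + x\<^sub>2 + x\<^sub>3 + x\<^sub>4 \<le> n"
     "\<bar>P\<bar> \<le> real p * x\<^sub>1 powr \<alpha>" "\<bar>Q\<bar> \<le> real p * x\<^sub>2 powr \<alpha>" "\<bar>A\<bar> \<le> real p * real q * x\<^sub>3 powr \<alpha>" "\<bar>B\<bar> \<le> real q * x\<^sub>4 powr \<alpha>"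
     "real_of_int i = real p * (P + Q) + A" "real_of_int j = P - Q + B" by (rule split_boundE)
  have qp: "real q * x powr \<alpha> \<le> real p * x powr \<alpha>" for x
    using q_less_p by (intro mult_right_mono) auto
  have "real p * \<bar>P + Q\<bar> \<le> real p * (real p * x\<^sub>1 powr \<alpha> + real p * x\<^sub>2 powr \<alpha>)"
    using 1(6,7) by (intro mult_left_mono) auto
  moreover have "\<bar>A\<bar> \<le> real p * (real p * x\<^sub>3 powr \<alpha>)"
    using 1(8) mult_left_mono[OF qp[of x\<^sub>3], of "real p"] by (simp add: mult.assoc)
  moreover have "\<bar>real_of_int i\<bar> \<le> real p * \<bar>P + Q\<bar> + \<bar>A\<bar>"
    using abs_triangle_ineq[of "real p * (P + Q)" A] by (simp add: 1(10) abs_mult)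
  ultimately have "\<bar>real_of_int i\<bar> \<le> real p * (real p * x\<^sub>1 powr \<alpha> + real p * x\<^sub>2 powr \<alpha>) + real p * (real p * x\<^sub>3 powr \<alpha>)"
    by linarith
  also have "\<dots> = real p * (real p * (x\<^sub>1 powr \<alpha> + x\<^sub>2 powr \<alpha> + x\<^sub>3 powr \<alpha>))"
    by (simp add: algebra_simps)
  also have "\<dots> \<le> real p * (real p * n powr \<alpha>)"
    using 1(1-5) by (intro mult_left_mono powr_\<alpha>_sum3) auto
  finally show "\<bar>real_of_int i\<bar> \<le> real p * real p * n powr \<alpha>" by (simp add: mult.assoc)
  have "\<bar>real_of_int j\<bar> \<le> real p * (x\<^sub>1 powr \<alpha> + x\<^sub>2 powr \<alpha> + x\<^sub>4 powr \<alpha>)"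
    using 1(6,7,9) qp[of x\<^sub>4] by (simp add: 1(11) algebra_simps abs_le_iff)
  also have "\<dots> \<le> real p * n powr \<alpha>"
    using 1(1-5) by (intro mult_left_mono powr_\<alpha>_sum3) auto
  finally show "\<bar>real_of_int j\<bar> \<le> real p * n powr \<alpha>" .
qed

lemma split_bound_base:
  "split_bound 1 (unit_sign b) 0" "split_bound 1 0 (unit_sign b)" "0 \<le> n \<Longrightarrow> split_bound n 0 0"
proof -
  have pq: "1 \<le> real p * real q" "1 \<le> real q"
    using p_pos q_pos by (simp_all add: Suc_leI flip: of_nat_mult)
  show "split_bound 1 (unit_sign b) 0"
    by (rule split_boundI[of 0 0 1 0 1 0 0 "unit_sign b" 0]) (use pq in auto)
  show "split_bound 1 0 (unit_sign b)"
    by (rule split_boundI[of 0 0 0 1 1 0 0 0 "unit_sign b"]) (use pq in auto)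
  show "0 \<le> n \<Longrightarrow> split_bound n 0 0"
    by (rule split_boundI[of 0 0 0 0 n 0 0 0 0]) auto
qed

text \<open>
  A pinch by \<open>s\<close> or \<open>t\<close> moves the \<open>a\<close> axis, where the bound is better, to one of the general directions
  \<open>P\<close>, \<open>Q\<close>; the inverse letters go back and gain what is lost, and \<open>\<theta>\<close> fixes the \<open>b\<close> axis.
\<close>
lemma split_bound_pinch:
  assumes "split_bound n (i * fst (c e)) (i * snd (c e))" "0 \<le> n"
  shows "\<bar>real_of_int i\<bar> \<le> real p * n powr \<alpha>"
    and "split_bound n (i * fst (c (flip_sign e))) (i * snd (c (flip_sign e)))"
proof -
  have "\<bar>real_of_int i\<bar> \<le> real p * n powr \<alpha> \<and>
    split_bound n (i * fst (c (flip_sign e))) (i * snd (c (flip_sign e)))"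
  proof (cases e rule: c.cases)
    case (1 b)
    show ?thesis
    proof (cases b)
      case True
      then have "\<bar>real_of_int (i * int q)\<bar> \<le> real p * real q * n powr \<alpha>"
        using assms by (intro split_bound_a_axis) (simp add: 1)
      then have i: "\<bar>real_of_int i\<bar> \<le> real p * n powr \<alpha>" using q_pos by (simp add: abs_mult mult.commute mult.left_commute)
      then have "split_bound n (i * int p) i"
        using assms(2) by (intro split_boundI[of n 0 0 0 n i 0 0 0]) (auto simp: mult.commute)
      then show ?thesis using i True by (simp add: 1)
    next
      case False
      then have i: "\<bar>real_of_int i\<bar> \<le> real p * n powr \<alpha>"
        using assms split_bound_general(2)[of n "i * int p" i] by (simp add: 1)
      then have "\<bar>real_of_int i * real q\<bar> \<le> real p * real q * n powr \<alpha>"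
        using mult_right_mono[OF i, of "real q"] by (simp add: abs_mult algebra_simps)
      then have "split_bound n (i * int q) 0"
        using assms(2) by (intro split_boundI[of 0 0 n 0 n 0 0 "i * int q" 0]) auto
      then show ?thesis using i False by (simp add: 1)
    qed
  next
    case (2 b)
    show ?thesis
    proof (cases b)
      case True
      then have "\<bar>real_of_int (i * int q)\<bar> \<le> real p * real q * n powr \<alpha>"
        using assms by (intro split_bound_a_axis) (simp add: 2)
      then have i: "\<bar>real_of_int i\<bar> \<le> real p * n powr \<alpha>" using q_pos by (simp add: abs_mult mult.commute mult.left_commute)
      then have "split_bound n (i * int p) (- i)"
        using assms(2) by (intro split_boundI[of 0 n 0 0 n 0 i 0 0]) (auto simp: mult.commute)
      then show ?thesis using i True by (simp add: 2)
    next
      case False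
      then have i: "\<bar>real_of_int i\<bar> \<le> real p * n powr \<alpha>"
        using assms split_bound_general(2)[of n "i * int p" "- i"] by (simp add: 2)
      then have "\<bar>real_of_int i * real q\<bar> \<le> real p * real q * n powr \<alpha>"
        using mult_right_mono[OF i, of "real q"] by (simp add: abs_mult algebra_simps)
      then have "split_bound n (i * int q) 0"
        using assms(2) by (intro split_boundI[of 0 0 n 0 n 0 0 "i * int q" 0]) auto
      then show ?thesis using i False by (simp add: 2)
    qed
  next
    case (3 b)
    then have "\<bar>real_of_int i\<bar> \<le> real q * n powr \<alpha>"
      using assms by (intro split_bound_b_axis) simp
    moreover have "real q * n powr \<alpha> \<le> real p * n powr \<alpha>"
      using q_less_p by (intro mult_right_mono) auto
    ultimately show ?thesis using assms by (simp add: 3)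
  qed
  then show "\<bar>real_of_int i\<bar> \<le> real p * n powr \<alpha>"
    and "split_bound n (i * fst (c (flip_sign e))) (i * snd (c (flip_sign e)))" by auto
qed

text \<open>
  For the exponent of \<open>z\<close>: each pair of letters \<open>\<theta>\<close> adds at most the exponent of \<open>b\<close>, which is
  \<open>O(n\<^sup>\<alpha>)\<close>, and this is absorbed by the increase of \<open>n\<^bsup>\<alpha>+1\<^esup>\<close>.
\<close>
theorem base_distortion:
  assumes "pinches w (i, j, k)"
  shows "split_bound (length w) i j" "\<bar>real_of_int k\<bar> \<le> real p * real (length w) powr (\<alpha> + 1)"
proof -
  have sup: "\<bar>u + v\<bar> \<le> real p * (x + y) powr (\<alpha> + 1)"
    if "\<bar>u\<bar> \<le> real p * x powr (\<alpha> + 1)" "\<bar>v\<bar> \<le> real p * y powr (\<alpha> + 1)" "0 \<le> x" "0 \<le> y" for u v x y :: real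
  proof -
    have "real p * (x powr (\<alpha> + 1) + y powr (\<alpha> + 1)) \<le> real p * (x + y) powr (\<alpha> + 1)"
      using that powr_superadd[of x y "\<alpha> + 1"] \<alpha>_ge_1 by (intro mult_left_mono) auto
    then show ?thesis using that(1,2) by (simp add: distrib_left)
  qed
  have "split_bound (length w) (fst m) (fst (snd m)) \<and>
    \<bar>real_of_int (snd (snd m))\<bar> \<le> real p * real (length w) powr (\<alpha> + 1)" if "pinches w m" for w m
    using that
  proof (induction rule: pinches.induct)
    case pinches_Nil
    then show ?case by (simp add: split_bound_base(3))
  next
    case (pinches_base l m w m')
    have p1: "1 \<le> real p" using p_pos by simp
    have "split_bound 1 (fst m) (fst (snd m)) \<and> \<bar>real_of_int (snd (snd m))\<bar> \<le> real p * 1 powr (\<alpha> + 1)"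
      using pinches_base(1) split_bound_base p1 by (cases l rule: letter_type.cases) auto
    then show ?case
      using pinches_base.IH split_bound_add[of 1 "fst m" "fst (snd m)" "length w"]
        sup[of "snd (snd m)" 1 "snd (snd m')" "length w"] by simp
  next
    case (pinches_pinch w h e w' m')
    obtain i k where h: "h = edge_elt e i k" using pinches_pinch(2) by (auto simp: edge_group_def)
    let ?n = "real (length w)"
    have sb: "split_bound ?n (i * fst (c e)) (i * snd (c e))" using pinches_pinch.IH(1) by (simp add: h edge_elt_def)
    note pinch = split_bound_pinch[OF sb]
    have sb': "split_bound (?n + 2) (i * fst (c (flip_sign e))) (i * snd (c (flip_sign e)))"
      by (rule split_bound_mono[OF pinch(2)]) auto
    have "\<bar>twist e\<bar> \<le> 1" by (cases e rule: twist.cases) auto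
    then have "\<bar>twist e * i\<bar> \<le> \<bar>i\<bar>" by (metis abs_ge_zero abs_mult mult.commute mult.right_neutral mult_left_mono)
    then have ti: "\<bar>real_of_int (twist e * i)\<bar> \<le> \<bar>real_of_int i\<bar>" by linarith
    have "\<bar>real_of_int k\<bar> \<le> real p * ?n powr (\<alpha> + 1)"
      using pinches_pinch.IH(1) by (simp add: h edge_elt_def)
    then have "\<bar>real_of_int (k + twist e * i)\<bar> \<le> real p * ?n powr (\<alpha> + 1) + real p * ?n powr \<alpha>"
      using pinch(1) ti by simp
    also have "\<dots> = real p * (?n powr \<alpha> * (?n + 1))"
      by (cases "w = []") (simp_all add: powr_add algebra_simps)
    also have "\<dots> \<le> real p * ((?n + 2) powr \<alpha> * (?n + 2) powr 1)"
      using \<alpha>_ge_1 by (intro mult_left_mono mult_mono powr_mono2) auto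
    also have "\<dots> = real p * (?n + 2) powr (\<alpha> + 1)" by (simp only: powr_add)
    finally have z: "\<bar>real_of_int (k + twist e * i)\<bar> \<le> real p * (?n + 2) powr (\<alpha> + 1)" .
    have m: "edge_iso e h = (i * fst (c (flip_sign e)), i * snd (c (flip_sign e)), k + twist e * i)"
      by (simp add: h) (simp add: edge_elt_def)
    have len: "real (length (stab_letter (flip_sign e) # w @ stab_letter e # w')) = (?n + 2) + real (length w')"
      by simp
    show ?case
      unfolding len m
      using split_bound_add[OF sb' conjunct1[OF pinches_pinch.IH(2)]] sup[OF z conjunct2[OF pinches_pinch.IH(2)]]
      by simp
  qed
  from this[OF assms] show "split_bound (length w) i j" "\<bar>real_of_int k\<bar> \<le> real p * real (length w) powr (\<alpha> + 1)"
    by auto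
qed

end

section \<open>Short conjugators\<close>

lemma not_successively_rotate:
  assumes "\<not> successively P ys"
  shows "\<exists>r. \<not> P (last (rotate r ys)) (hd (rotate r ys))"
proof -
  have "\<exists>xs x y zs. ys = xs @ x # y # zs \<and> \<not> P x y"
    using assms
  proof (induction ys rule: induct_list012)
    case (3 x y zs)
    show ?case
    proof (cases "P x y")
      case True
      then obtain xs x' y' zs' where "y # zs = xs @ x' # y' # zs'" "\<not> P x' y'"
        using 3 by auto
      then show ?thesis by (intro exI[of _ "x # xs"]) auto
    qed (auto intro!: exI[of _ "[]"])
  qed auto
  then obtain xs x y zs where ys: "ys = (xs @ [x]) @ (y # zs)" "\<not> P x y" by auto
  then have "rotate (length (xs @ [x])) ys = (y # zs) @ (xs @ [x])"
    using rotate_append[of "xs @ [x]" "y # zs"] by simp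
  then show ?thesis using ys(2) by (intro exI[of _ "length (xs @ [x])"]) simp
qed

lemma abs_le_abs_mult:
  fixes i j :: int
  assumes "i \<noteq> 0"
  shows "\<bar>j\<bar> \<le> \<bar>i * j\<bar>"
proof -
  have "1 \<le> \<bar>i\<bar>" using assms by linarith
  from mult_right_mono[OF this, of "\<bar>j\<bar>"] show ?thesis by (simp add: abs_mult)
qed

context snowflake
begin

lemma abs_c_le: "\<bar>fst (c e)\<bar> \<le> int p" "\<bar>snd (c e)\<bar> \<le> 1"
  using q_less_p by (cases e rule: c.cases; simp)+

lemma c_det:
  assumes "c e \<noteq> c e'"
  shows "fst (c e) * snd (c e') - snd (c e) * fst (c e') \<noteq> 0"
  using assms p_pos q_pos by (cases e rule: c.cases; cases e' rule: c.cases) (auto split: if_splits)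

lemma edge_elt_inj:
  assumes "fst (c e) \<noteq> 0" "fst (c e') \<noteq> 0" "edge_elt e i k = edge_elt e' i' k'"
  shows "i = i'"
  using assms p_pos q_pos
  by (cases e rule: c.cases; cases e' rule: c.cases) (auto simp: edge_elt_def split: if_splits)

lemma val_replicate:
  assumes "letter_type l = Inl (x, y, z)"
  shows "val (replicate n l) = \<mu> (int n * x, int n * y, int n * z)"
  by (induction n) (simp_all add: lval_def assms \<mu>_000 algebra_simps flip: \<mu>_add)

definition power_word :: "B_gen \<Rightarrow> int \<Rightarrow> B_gen gword" where
  "power_word x i = replicate (nat \<bar>i\<bar>) (x, 0 \<le> i)"

lemma length_power_word [simp]: "length (power_word x i) = nat \<bar>i\<bar>"
  by (simp add: power_word_def)

lemma val_power_word: "val (power_word Ba i) = \<mu> (i, 0, 0)" "val (power_word Bb i) = \<mu> (0, i, 0)"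
  by (simp_all add: power_word_def val_replicate[of _ "unit_sign (0 \<le> i)" 0 0] val_replicate[of _ 0 "unit_sign (0 \<le> i)" 0])

lemma short_base_word:
  "\<exists>w. val w = \<mu> (edge_elt e i 0) \<and> length w \<le> (p + 1) * nat \<bar>i\<bar>"
proof (intro exI conjI)
  let ?w = "power_word Ba (i * fst (c e)) @ power_word Bb (i * snd (c e))"
  show "val ?w = \<mu> (edge_elt e i 0)" by (simp add: val_power_word edge_elt_def flip: \<mu>_add)
  have "\<bar>i\<bar> * \<bar>fst (c e)\<bar> + \<bar>i\<bar> * \<bar>snd (c e)\<bar> \<le> \<bar>i\<bar> * int p + \<bar>i\<bar> * 1"
    by (intro add_mono mult_left_mono abs_c_le) auto
  then have "int (length ?w) \<le> int ((p + 1) * nat \<bar>i\<bar>)"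
    by (simp add: abs_mult algebra_simps)
  then show "length ?w \<le> (p + 1) * nat \<bar>i\<bar>" by (simp only: zle_int)
qed

lemma \<mu>_val_theta: "\<mu> (0, j, k) + val (power_word Btheta l) = val (power_word Btheta l) + \<mu> (0, j, k + j * l)"
proof -
  have "\<mu> (0, j, k) + val (replicate n (Btheta, b)) = val (replicate n (Btheta, b)) + \<mu> (0, j, k + j * (unit_sign b * int n))"
    for n b k
  proof (induction n arbitrary: k)
    case (Suc n)
    have "\<mu> (0, j, k) + t (Sth, b) = t (Sth, b) + \<mu> (0, j, k + unit_sign b * j)"
      using \<mu>_t[OF edge_elt_in[of "(Sth, b)" j k]] by (simp add: edge_elt_def) (simp add: edge_iso_def edge_index_def edge_elt_def)
    then have "\<mu> (0, j, k) + val (replicate (Suc n) (Btheta, b)) =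
        t (Sth, b) + (\<mu> (0, j, k + unit_sign b * j) + val (replicate n (Btheta, b)))"
      by (simp add: lval_simps flip: add.assoc)
    also have "\<dots> = val (replicate (Suc n) (Btheta, b)) + \<mu> (0, j, k + unit_sign b * j + j * (unit_sign b * int n))"
      unfolding Suc by (simp add: lval_simps add.assoc)
    also have "k + unit_sign b * j + j * (unit_sign b * int n) = k + j * (unit_sign b * int (Suc n))"
      by (simp add: algebra_simps)
    finally show ?case .
  qed simp
  from this[of k "nat \<bar>l\<bar>" "0 \<le> l"] show ?thesis by (simp add: power_word_def)
qed

text \<open>
  The conjugacy relation that the stable letters induce on the base group: an element on the \<open>b\<close> axis is
  sheared by powers of \<open>\<theta>\<close>, an element of one of the other edge groups moves between them, and every
  other element is alone.
\<close>
definition conj_related :: "nat \<Rightarrow> int \<times> int \<times> int \<Rightarrow> int \<times> int \<times> int \<Rightarrow> bool" where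
  "conj_related n g g' \<longleftrightarrow> g' = g \<or>
    (\<exists>j k l. g = (0, j, k) \<and> g' = (0, j, k + j * l) \<and> nat \<bar>l\<bar> \<le> n) \<or>
    (\<exists>e e' i k. fst (c e) \<noteq> 0 \<and> fst (c e') \<noteq> 0 \<and> g = edge_elt e i k \<and> g' = edge_elt e' i k)"

lemma chain_related: "chain g es g' \<Longrightarrow> conj_related (length es) g g'"
proof (induction es arbitrary: g)
  case Nil
  then show ?case by (simp add: conj_related_def)
next
  case (Cons x es)
  then have "g \<in> edge_group x" "chain (edge_iso x g) es g'" by simp_all
  then obtain i k where g: "g = edge_elt x i k" and ch: "chain (edge_iso x g) es g'"
    by (auto simp: edge_group_def)
  have IH: "conj_related (length es) (edge_elt (flip_sign x) i (k + twist x * i)) g'"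
    using Cons.IH[OF ch] by (simp add: g)
  show ?case
  proof (cases "fst (c x) = 0")
    case True
    then obtain b where x: "x = (Sth, b)" using p_pos q_pos by (cases x rule: c.cases) (auto split: if_splits)
    have g0: "g = (0, i, k)" "edge_elt (flip_sign x) i (k + twist x * i) = (0, i, k + i * unit_sign b)"
      by (simp_all add: g x edge_elt_def)
    from IH[unfolded g0 conj_related_def] show ?thesis
    proof (elim disjE exE conjE)
      assume "g' = (0, i, k + i * unit_sign b)"
      then show ?thesis unfolding conj_related_def g0 by (intro disjI2 disjI1 exI[of _ i] exI[of _ k] exI[of _ "unit_sign b"]) auto
    next
      fix j k' l assume "(0, i, k + i * unit_sign b) = (0 :: int, j, k')" "g' = (0, j, k' + j * l)" "nat \<bar>l\<bar> \<le> length es"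
      then show ?thesis unfolding conj_related_def g0
        by (intro disjI2 disjI1 exI[of _ i] exI[of _ k] exI[of _ "unit_sign b + l"]) (auto simp: algebra_simps)
    next
      fix e e' i' k' assume e: "fst (c e) \<noteq> 0" "(0, i, k + i * unit_sign b) = edge_elt e i' k'" "g' = edge_elt e' i' k'"
      then have "i' = 0" "i = 0" by (auto simp: edge_elt_def)
      then show ?thesis using e by (simp add: conj_related_def g0 edge_elt_def)
    qed
  next
    case False
    then have nz: "fst (c (flip_sign x)) \<noteq> 0" and tw0: "twist x = 0"
      using p_pos q_pos by (cases x rule: c.cases; simp)+
    from IH[unfolded conj_related_def tw0] show ?thesis
    proof (elim disjE exE conjE)
      assume "g' = edge_elt (flip_sign x) i (k + 0 * i)"
      then show ?thesis unfolding conj_related_def g using False nz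
        by (intro disjI2 exI[of _ x] exI[of _ "flip_sign x"] exI[of _ i] exI[of _ k]) simp
    next
      fix j k' l assume *: "edge_elt (flip_sign x) i (k + 0 * i) = (0, j, k')" "g' = (0, j, k' + j * l)"
      then have "i = 0" using nz by (simp add: edge_elt_def)
      then show ?thesis using * by (auto simp: conj_related_def g edge_elt_def)
    next
      fix e e' i' k' assume e: "fst (c e) \<noteq> 0" "fst (c e') \<noteq> 0"
        "edge_elt (flip_sign x) i (k + 0 * i) = edge_elt e i' k'" "g' = edge_elt e' i' k'"
      then have "i' = i" using edge_elt_inj nz by metis
      moreover from e(3) have "k' = k" by (simp add: edge_elt_def)
      ultimately show ?thesis unfolding conj_related_def g using e False
        by (intro disjI2 exI[of _ x] exI[of _ e'] exI[of _ i] exI[of _ k]) simp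
    qed
  qed
qed

lemma conj_to_a_axis:
  assumes "fst (c e) \<noteq> 0"
  shows "\<exists>w. length w \<le> 1 \<and> \<mu> (edge_elt e i k) + val w = val w + \<mu> (i * int q, 0, k)"
proof -
  have tw0: "twist e = 0" and ax: "snd e \<Longrightarrow> edge_elt e i k = (i * int q, 0, k)"
      "\<not> snd e \<Longrightarrow> edge_elt (flip_sign e) i k = (i * int q, 0, k)"
    using assms by (cases e rule: c.cases; simp add: edge_elt_def)+
  show ?thesis
  proof (cases "snd e")
    case True
    then show ?thesis using ax by (intro exI[of _ "[]"]) simp
  next
    case False
    then show ?thesis using \<mu>_t[OF edge_elt_in[of e i k]] ax tw0
      by (intro exI[of _ "[stab_letter e]"]) simp
  qed
qed

text \<open>
  Large enough for each kind of conjugator. The value comes from \<open>conjw_not_parallel\<close>: there an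
  exponent is bounded by four terms of size at most \<open>p\<^sup>2 n\<^sup>\<alpha>\<close>, and each unit of it costs at most
  \<open>p + 1\<close> letters.
\<close>
definition conj_const :: real where
  "conj_const = 4 * real p * real p * (real p + 1)"

lemma conj_const_bounds: "2 * real p \<le> conj_const" "(real p + 1) * real p \<le> conj_const" "0 \<le> conj_const"
proof -
  have p1: "1 \<le> real p" using p_pos by simp
  then have "1 * 2 \<le> (2 * real p) * (real p + 1)" by (intro mult_mono) auto
  from mult_left_mono[OF this, of "2 * real p"] show "2 * real p \<le> conj_const"
    by (simp add: conj_const_def algebra_simps)
  have "1 * ((real p + 1) * real p) \<le> 4 * real p * ((real p + 1) * real p)"
    using p1 by (intro mult_right_mono) auto
  then show "(real p + 1) * real p \<le> conj_const" by (simp add: conj_const_def algebra_simps)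
qed (simp add: conj_const_def)

definition conj_bound :: "nat \<Rightarrow> nat" where
  "conj_bound n = nat \<lfloor>2 + conj_const * real n powr (\<alpha> + 1)\<rfloor>"

lemma le_conj_bound: "real m \<le> conj_const * real n powr (\<alpha> + 1) \<Longrightarrow> m \<le> conj_bound n"
  unfolding conj_bound_def by (intro le_nat_floor) simp

lemma two_le_conj_bound: "2 \<le> conj_bound n"
  unfolding conj_bound_def using conj_const_bounds(3) by (intro le_nat_floor) simp

lemma powr_\<alpha>_le: "real n powr \<alpha> \<le> real n powr (\<alpha> + 1)"
  by (cases "n = 0") (auto intro: powr_mono)

text \<open>
  If \<open>b\<^sup>j z\<^sup>k\<close> is sheared to \<open>b\<^sup>j z\<^bsup>k+jl\<^esup>\<close> with \<open>j \<noteq> 0\<close>, the exponent \<open>l\<close> of \<open>\<theta>\<close> is at most \<open>\<bar>j l\<bar>\<close>, a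
  difference of exponents of \<open>z\<close> that short words attain.
\<close>
lemma conjw_elliptic:
  assumes "pinches u g" "pinches v g'" "chain g es g'" "length u \<le> n" "length v \<le> n"
  shows "conjw (conj_bound n) u v"
  using chain_related[OF assms(3)] unfolding conj_related_def
proof (elim disjE exE conjE)
  assume "g' = g"
  then show ?thesis using assms(1,2) by (intro conjwI[of "[]"]) (auto simp: val_pinches)
next
  fix j k l assume g: "g = (0, j, k)" "g' = (0, j, k + j * l)"
  show ?thesis
  proof (cases "j = 0")
    case True
    then show ?thesis using assms(1,2) g by (intro conjwI[of "[]"]) (auto simp: val_pinches)
  next
    case False
    have mono: "real p * real m powr (\<alpha> + 1) \<le> real p * real n powr (\<alpha> + 1)" if "m \<le> n" for m
      using that \<alpha>_ge_1 by (intro mult_left_mono powr_mono2) auto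
    have "\<bar>real_of_int k\<bar> \<le> real p * real n powr (\<alpha> + 1)"
      using base_distortion(2)[of u 0 j k] mono[OF assms(4)] assms(1) g by simp
    moreover have "\<bar>real_of_int (k + j * l)\<bar> \<le> real p * real n powr (\<alpha> + 1)"
      using base_distortion(2)[of v 0 j "k + j * l"] mono[OF assms(5)] assms(2) g by simp
    ultimately have "\<bar>real_of_int (j * l)\<bar> \<le> 2 * real p * real n powr (\<alpha> + 1)" by simp
    moreover have "\<bar>l\<bar> \<le> \<bar>j * l\<bar>" using abs_le_abs_mult[OF False] .
    then have "real (nat \<bar>l\<bar>) \<le> \<bar>real_of_int (j * l)\<bar>" by linarith
    moreover have "2 * real p * real n powr (\<alpha> + 1) \<le> conj_const * real n powr (\<alpha> + 1)"
      using conj_const_bounds(1) by (intro mult_right_mono) auto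
    ultimately have "nat \<bar>l\<bar> \<le> conj_bound n" by (intro le_conj_bound) linarith
    then show ?thesis using \<mu>_val_theta[of j k l] assms(1,2) g
      by (intro conjwI[of "power_word Btheta l"]) (simp_all add: val_pinches)
  qed
next
  fix e e' i k assume e: "fst (c e) \<noteq> 0" "fst (c e') \<noteq> 0" "g = edge_elt e i k" "g' = edge_elt e' i k"
  obtain w where w: "length w \<le> 1" "\<mu> g + val w = val w + \<mu> (i * int q, 0, k)"
    using conj_to_a_axis[OF e(1)] e(3) by blast
  obtain w' where w': "length w' \<le> 1" "\<mu> g' + val w' = val w' + \<mu> (i * int q, 0, k)"
    using conj_to_a_axis[OF e(2)] e(4) by blast
  let ?a = "power_word Ba (i * int q) @ power_word Bz k"
  have "val (power_word Bz k) = \<mu> (0, 0, k)"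
    by (simp add: power_word_def val_replicate[of _ 0 0 "unit_sign (0 \<le> k)"])
  then have a: "val ?a = \<mu> (i * int q, 0, k)" by (simp add: val_power_word flip: \<mu>_add)
  have "conjw (1 + 1) u v"
  proof (rule conjw_trans)
    show "conjw 1 u ?a" using w assms(1) by (intro conjwI[of w]) (auto simp: val_pinches a simp del: val_simps)
    show "conjw 1 ?a v" using w' assms(2)
      by (intro conjw_sym[OF conjwI[of w']]) (auto simp: val_pinches a simp del: val_simps)
  qed
  then show ?thesis unfolding one_add_one using two_le_conj_bound by (rule conjw_mono)
qed

lemma edge_elt_split: "\<mu> (edge_elt e i k) = \<mu> (edge_elt e i 0) + \<mu> (0, 0, k)"
  by (simp add: edge_elt_def flip: \<mu>_add)

text \<open>
  Only the part of a conjugator modulo \<open>z\<close> matters, as \<open>z\<close> is central.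
\<close>
lemma conj_drop_center:
  assumes "val u + \<mu> (edge_elt e i k) = \<mu> (edge_elt e i k) + val v"
  shows "val u + \<mu> (edge_elt e i 0) = \<mu> (edge_elt e i 0) + val v"
proof -
  have "(val u + \<mu> (edge_elt e i 0)) + \<mu> (0, 0, k) = \<mu> (edge_elt e i 0) + (\<mu> (0, 0, k) + val v)"
    using assms unfolding edge_elt_split[of e i k] by (simp add: add.assoc)
  also have "\<dots> = (\<mu> (edge_elt e i 0) + val v) + \<mu> (0, 0, k)"
    unfolding central by (simp add: add.assoc)
  finally show ?thesis by simp
qed

lemma conjw_edge_elt:
  assumes "val u + \<mu> (edge_elt e i 0) = \<mu> (edge_elt e i 0) + val v"
    and "(real p + 1) * \<bar>real_of_int i\<bar> \<le> conj_const * real n powr (\<alpha> + 1)"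
  shows "conjw (conj_bound n) u v"
proof -
  obtain w where w: "val w = \<mu> (edge_elt e i 0)" "length w \<le> (p + 1) * nat \<bar>i\<bar>"
    using short_base_word by blast
  have "real ((p + 1) * nat \<bar>i\<bar>) = (real p + 1) * \<bar>real_of_int i\<bar>" by (simp add: algebra_simps)
  then have "(p + 1) * nat \<bar>i\<bar> \<le> conj_bound n" using assms(2) by (intro le_conj_bound) simp
  then show ?thesis using w assms(1) by (intro conjwI[of w]) auto
qed

lemma push_last:
  assumes "push h (xs @ [(e, m)]) (xs' @ [(e', m')]) h'"
  obtains x where "x \<in> edge_group e" "h' = edge_iso e x + m' - m"
proof -
  have "length xs = length xs'" using push_length[OF assms] by simp
  then show thesis using assms that by (auto simp: push_append)
qed

text \<open>
  An edge group element that leaves the letter of one syllable is, modulo \<open>z\<close>, again a generator power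
  of the edge group of the next letter.
\<close>
abbreviation parallel :: "(stab \<times> bool) \<times> (int \<times> int \<times> int) \<Rightarrow> (stab \<times> bool) \<times> (int \<times> int \<times> int) \<Rightarrow> bool" where
  "parallel x y \<equiv> c (flip_sign (fst x)) = c (fst y)"

lemma parallel_commute:
  assumes "successively parallel ys" "ys \<noteq> []"
  shows "\<exists>\<sigma>. \<forall>i k. \<mu> (edge_elt (fst (hd ys)) i k) + syl_prod ys = syl_prod ys + \<mu> (edge_elt (flip_sign (fst (last ys))) i (k + \<sigma> * i))"
  using assms
proof (induction ys)
  case (Cons y ys)
  obtain e m where y: "y = (e, m)" by (cases y)
  have 1: "\<mu> (edge_elt e i k) + (t e + \<mu> m) = (t e + \<mu> m) + \<mu> (edge_elt (flip_sign e) i (k + twist e * i))" for i k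
  proof -
    have "\<mu> (edge_elt e i k) + (t e + \<mu> m) = t e + (\<mu> (edge_elt (flip_sign e) i (k + twist e * i)) + \<mu> m)"
      using \<mu>_t[OF edge_elt_in[of e i k]] by (simp flip: add.assoc)
    also have "\<dots> = (t e + \<mu> m) + \<mu> (edge_elt (flip_sign e) i (k + twist e * i))"
      unfolding \<mu>_commute[of _ m] by (simp add: add.assoc)
    finally show ?thesis .
  qed
  show ?case
  proof (cases "ys = []")
    case True
    then show ?thesis using 1 by (intro exI[of _ "twist e"]) (simp add: y)
  next
    case False
    then have par: "c (flip_sign e) = c (fst (hd ys))" "successively parallel ys"
      using Cons.prems by (auto simp: successively_Cons y)
    obtain \<sigma> where \<sigma>: "\<And>i k. \<mu> (edge_elt (fst (hd ys)) i k) + syl_prod ys = syl_prod ys + \<mu> (edge_elt (flip_sign (fst (last ys))) i (k + \<sigma> * i))"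
      using Cons.IH[OF par(2) False] by blast
    have "edge_elt (flip_sign e) i k = edge_elt (fst (hd ys)) i k" for i k using par(1) by (simp add: edge_elt_def)
    then have "\<mu> (edge_elt e i k) + syl_prod (y # ys) =
        syl_prod (y # ys) + \<mu> (edge_elt (flip_sign (fst (last ys))) i (k + twist e * i + \<sigma> * i))" for i k
    proof -
      assume eq: "\<And>i k. edge_elt (flip_sign e) i k = edge_elt (fst (hd ys)) i k"
      have "\<mu> (edge_elt e i k) + syl_prod (y # ys) = (\<mu> (edge_elt e i k) + (t e + \<mu> m)) + syl_prod ys"
        by (simp add: y add.assoc)
      also have "\<dots> = (t e + \<mu> m) + (\<mu> (edge_elt (fst (hd ys)) i (k + twist e * i)) + syl_prod ys)"
        unfolding 1 eq by (simp add: add.assoc)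
      finally show ?thesis unfolding \<sigma> by (simp add: y add.assoc)
    qed
    then show ?thesis using False by (intro exI[of _ "twist e + \<sigma>"]) (simp add: y algebra_simps)
  qed
qed simp

text \<open>
  Here the first word commutes with \<open>c\<^sup>i\<close> up to \<open>z\<^bsup>\<sigma>i\<^esup>\<close>, so the two words differ by this power of \<open>z\<close>.
  Either it is trivial and the words are equal, or \<open>\<bar>i\<bar> \<le> \<bar>\<sigma> i\<bar>\<close>, and \<open>z\<^bsup>\<sigma>i\<^esup>\<close> is a word of
  length at most \<open>n\<close>.
\<close>
lemma conjw_parallel:
  assumes "segs_pinch segs" "segs_pinch segs'" "segs \<noteq> []" "push h (syllables segs) (syllables segs') h"
    and par: "successively parallel (syllables segs)" "parallel (last (syllables segs)) (hd (syllables segs))"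
    and len: "length (flat segs) + length (flat segs') \<le> n"
  shows "conjw (conj_bound n) (flat segs) (flat segs')"
proof -
  let ?u = "flat segs" and ?v = "flat segs'" and ?e = "fst (hd (syllables segs))"
  obtain e m ys where ys: "syllables segs = (e, m) # ys" using assms(3) by (cases "syllables segs") auto
  then obtain e' m' ys' where ys': "syllables segs' = (e', m') # ys'"
    using push_length[OF assms(4)] by (cases "syllables segs'") auto
  have "h \<in> edge_group e" using assms(4) by (simp add: ys ys')
  then obtain i k where h: "h = edge_elt e i k" by (auto simp: edge_group_def)
  have "val ?u + \<mu> h = \<mu> h + val ?v"
    using push_sound[OF assms(4)] assms(1,2) by (simp add: val_flat)
  then have conj: "val ?u + \<mu> (edge_elt e i 0) = \<mu> (edge_elt e i 0) + val ?v"
    unfolding h by (rule conj_drop_center)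
  obtain \<sigma> where "\<mu> (edge_elt ?e i 0) + syl_prod (syllables segs) = syl_prod (syllables segs) + \<mu> (edge_elt (flip_sign (fst (last (syllables segs)))) i (0 + \<sigma> * i))"
    using parallel_commute[OF par(1)] assms(3) by auto
  moreover have "edge_elt (flip_sign (fst (last (syllables segs)))) i j = edge_elt e i j" for j
    using par(2) by (simp add: edge_elt_def ys)
  ultimately have "\<mu> (edge_elt e i 0) + val ?u = val ?u + \<mu> (edge_elt e i (\<sigma> * i))"
    using assms(1) by (simp add: val_flat ys)
  also have "\<dots> = \<mu> (edge_elt e i 0) + (val ?v + \<mu> (0, 0, \<sigma> * i))"
    unfolding edge_elt_split[of e i "\<sigma> * i"] using conj by (simp flip: add.assoc)
  finally have uv: "val ?u = val ?v + \<mu> (0, 0, \<sigma> * i)" by simp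
  show ?thesis
  proof (cases "\<sigma> * i = 0")
    case True
    have "val ?u = val ?v" using uv unfolding True by (simp add: \<mu>_000)
    then show ?thesis by (intro conjwI[of "[]"]) auto
  next
    case False
    have "val (winv ?v @ ?u) = \<mu> (0, 0, \<sigma> * i)" by (simp add: val_winv uv)
    then have "pinches (winv ?v @ ?u) (0, 0, \<sigma> * i)" by (simp only: pinches_iff)
    from base_distortion(2)[OF this]
    have "\<bar>real_of_int (\<sigma> * i)\<bar> \<le> real p * real (length ?u + length ?v) powr (\<alpha> + 1)"
      by (simp add: winv_def add.commute)
    also have "\<dots> \<le> real p * real n powr (\<alpha> + 1)"
      using len \<alpha>_ge_1 by (intro mult_left_mono powr_mono2) auto
    finally have "\<bar>real_of_int (\<sigma> * i)\<bar> \<le> real p * real n powr (\<alpha> + 1)" .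
    moreover have "\<bar>i\<bar> \<le> \<bar>\<sigma> * i\<bar>" using False by (intro abs_le_abs_mult) auto
    ultimately have "\<bar>real_of_int i\<bar> \<le> real p * real n powr (\<alpha> + 1)" by linarith
    then have "(real p + 1) * \<bar>real_of_int i\<bar> \<le> (real p + 1) * (real p * real n powr (\<alpha> + 1))"
      by (intro mult_left_mono) auto
    also have "\<dots> \<le> conj_const * real n powr (\<alpha> + 1)"
      using mult_right_mono[OF conj_const_bounds(2), of "real n powr (\<alpha> + 1)"] by (simp add: mult.assoc)
    finally show ?thesis using conj by (rule_tac conjw_edge_elt)
  qed
qed

lemma pinches_bounds:
  assumes "pinches w (i, j, k)" "length w \<le> n"
  shows "\<bar>real_of_int i\<bar> \<le> real p * real p * real n powr \<alpha>" "\<bar>real_of_int j\<bar> \<le> real p * real n powr \<alpha>"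
  using split_bound_general[OF split_bound_mono[OF base_distortion(1)[OF assms(1)], of n]] assms(2) by auto

text \<open>
  Where two directions meet, the conjugator is a multiple of one of them and, up to the difference
  \<open>m' - m\<close> of two short base words, of the other; Cramer's rule determines it.
\<close>
lemma conjw_not_parallel:
  assumes "segs_pinch segs" "segs_pinch segs'" "segs \<noteq> []" "push h (syllables segs) (syllables segs') h"
    and npar: "\<not> parallel (last (syllables segs)) (hd (syllables segs))"
    and len: "length (flat segs) \<le> n" "length (flat segs') \<le> n"
  shows "conjw (conj_bound n) (flat segs) (flat segs')"
proof -
  let ?u = "flat segs" and ?v = "flat segs'"
  obtain e1 m1 ys where ys: "syllables segs = (e1, m1) # ys" using assms(3) by (cases "syllables segs") auto
  then obtain e1' m1' ys' where ys': "syllables segs' = (e1', m1') # ys'"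
    using push_length[OF assms(4)] by (cases "syllables segs'") auto
  have "h \<in> edge_group e1" using assms(4) by (simp add: ys ys')
  then obtain i k where h: "h = edge_elt e1 i k" by (auto simp: edge_group_def)
  have "val ?u + \<mu> h = \<mu> h + val ?v"
    using push_sound[OF assms(4)] assms(1,2) by (simp add: val_flat)
  then have conj: "val ?u + \<mu> (edge_elt e1 i 0) = \<mu> (edge_elt e1 i 0) + val ?v"
    unfolding h by (rule conj_drop_center)
  obtain zs e w m where zs: "segs = zs @ [(e, w, m)]"
    using assms(3) by (metis rev_exhaust prod_cases3)
  have "segs' \<noteq> []" using ys' by auto
  then obtain zs' e' w' m' where zs': "segs' = zs' @ [(e', w', m')]"
    by (metis rev_exhaust prod_cases3)
  obtain x where x: "x \<in> edge_group e" "h = edge_iso e x + m' - m"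
    using assms(4) unfolding zs zs' by (auto elim: push_last)
  then obtain i' k' where h': "h = edge_elt (flip_sign e) i' k' + m' - m" by (auto simp: edge_group_def)
  obtain d1 d2 d3 where m: "m = (d1, d2, d3)" by (cases m)
  obtain d1' d2' d3' where m': "m' = (d1', d2', d3')" by (cases m')
  let ?c = "c e1" and ?f = "c (flip_sign e)"
  have eqs: "i * fst ?c = i' * fst ?f + (d1' - d1)" "i * snd ?c = i' * snd ?f + (d2' - d2)"
    using h h' by (simp_all add: edge_elt_def m m')
  \<comment> \<open>The determinant of the two directions is a nonzero integer.\<close>
  let ?D = "fst ?c * snd ?f - snd ?c * fst ?f"
  have "last (syllables segs) = (e, m)" by (simp add: zs)
  moreover have "hd (syllables segs) = (e1, m1)" by (simp add: ys)
  ultimately have "?c \<noteq> ?f" using npar by auto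
  then have D: "?D \<noteq> 0" by (rule c_det)
  have "i * ?D = (i * fst ?c) * snd ?f - (i * snd ?c) * fst ?f" by (simp add: algebra_simps)
  also have "\<dots> = (d1' - d1) * snd ?f - (d2' - d2) * fst ?f"
    unfolding eqs by (simp add: algebra_simps)
  finally have iD: "\<bar>i * ?D\<bar> \<le> \<bar>(d1' - d1) * snd ?f\<bar> + \<bar>(d2' - d2) * fst ?f\<bar>" by linarith
  also have "\<dots> \<le> \<bar>d1' - d1\<bar> * 1 + \<bar>d2' - d2\<bar> * int p"
    unfolding abs_mult by (intro add_mono mult_left_mono abs_c_le) auto
  finally have "\<bar>i * ?D\<bar> \<le> \<bar>d1' - d1\<bar> + \<bar>d2' - d2\<bar> * int p" by simp
  moreover have "\<bar>i\<bar> \<le> \<bar>i * ?D\<bar>" using abs_le_abs_mult[OF D, of i] by (simp only: mult.commute)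
  ultimately have "\<bar>i\<bar> \<le> \<bar>d1' - d1\<bar> + \<bar>d2' - d2\<bar> * int p" by linarith
  then have "real_of_int \<bar>i\<bar> \<le> real_of_int (\<bar>d1' - d1\<bar> + \<bar>d2' - d2\<bar> * int p)" by linarith
  then have i: "\<bar>real_of_int i\<bar> \<le> \<bar>real_of_int d1' - real_of_int d1\<bar> + \<bar>real_of_int d2' - real_of_int d2\<bar> * real p"
    by simp
  let ?N = "real n powr \<alpha>"
  have "length w \<le> n" "length w' \<le> n" "pinches w m" "pinches w' m'"
    using len assms(1,2) by (auto simp: zs zs')
  then have b: "\<bar>real_of_int d1\<bar> \<le> real p * real p * ?N" "\<bar>real_of_int d2\<bar> \<le> real p * ?N"
    "\<bar>real_of_int d1'\<bar> \<le> real p * real p * ?N" "\<bar>real_of_int d2'\<bar> \<le> real p * ?N"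
    using pinches_bounds[of w d1 d2 d3 n] pinches_bounds[of w' d1' d2' d3' n] by (simp_all add: m m')
  have "\<bar>real_of_int d2' - real_of_int d2\<bar> * real p \<le> (2 * (real p * ?N)) * real p"
    using b by (intro mult_right_mono) auto
  then have "\<bar>real_of_int i\<bar> \<le> 4 * real p * real p * ?N" using i b by (simp add: algebra_simps)
  then have "(real p + 1) * \<bar>real_of_int i\<bar> \<le> (real p + 1) * (4 * real p * real p * ?N)"
    by (intro mult_left_mono) auto
  also have "\<dots> = conj_const * ?N" by (simp add: conj_const_def)
  also have "\<dots> \<le> conj_const * real n powr (\<alpha> + 1)" using powr_\<alpha>_le conj_const_bounds(3) by (intro mult_left_mono)
  finally show ?thesis using conj by (rule_tac conjw_edge_elt)
qed

text \<open>
  In the hyperbolic case a rotation brings a junction with two different directions, if there is any,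
  to the end of the word; conjugation by rotations costs at most \<open>n\<close> letters in total.
\<close>
theorem conjw_upper:
  assumes "val u + val g = val g + val v" "length u + length v \<le> n"
  shows "conjw (n + conj_bound n) u v"
  using assms(1)
proof (cases rule: conj_classification)
  case (elliptic r r' x x' es)
  have "conjw (conj_bound n) (rotate r u) (rotate r' v)"
    using elliptic assms(2) by (intro conjw_elliptic) auto
  then have "conjw (length u + (conj_bound n + length v)) u v"
    by (intro conjw_trans[OF conjw_rotate] conjw_trans[OF _ conjw_sym[OF conjw_rotate]])
  then show ?thesis using assms(2) by (rule_tac conjw_mono) auto
next
  case (hyperbolic r r' segs segs' h)
  have len: "length (flat segs) = length u" "length (flat segs') = length v"
    using hyperbolic(1,2) by (metis length_rotate)+
  have "\<exists>k. conjw (conj_bound n) (flat (rotate k segs)) (flat (rotate k segs'))"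
  proof (cases "successively parallel (syllables segs) \<and> parallel (last (syllables segs)) (hd (syllables segs))")
    case True
    then have "conjw (conj_bound n) (flat (rotate 0 segs)) (flat (rotate 0 segs'))"
      using hyperbolic assms(2) len unfolding rotate0 id_apply by (intro conjw_parallel[of _ _ h]) auto
    then show ?thesis by blast
  next
    case False
    have "\<exists>k. \<not> parallel (last (rotate k (syllables segs))) (hd (rotate k (syllables segs)))"
    proof (cases "successively parallel (syllables segs)")
      case True
      then show ?thesis using False by (intro exI[of _ 0]) simp
    next
      case False
      then show ?thesis by (rule not_successively_rotate)
    qed
    then obtain k where k: "\<not> parallel (last (rotate k (syllables segs))) (hd (rotate k (syllables segs)))" by blast
    obtain h' where h': "push h' (rotate k (syllables segs)) (rotate k (syllables segs')) h'"
      using push_rotate[OF hyperbolic(6)] by blast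
    have lenk: "length (flat (rotate k xs)) = length (flat xs)" for xs :: "((stab \<times> bool) \<times> B_gen gword \<times> (int \<times> int \<times> int)) list"
      using flat_rotate[of k xs] by auto
    have "conjw (conj_bound n) (flat (rotate k segs)) (flat (rotate k segs'))"
      using hyperbolic h' k assms(2) by (intro conjw_not_parallel[of _ _ h']) (auto simp: syllables_rotate lenk len)
    then show ?thesis by blast
  qed
  then obtain k where k: "conjw (conj_bound n) (flat (rotate k segs)) (flat (rotate k segs'))" by blast
  obtain s s' where "flat (rotate k segs) = rotate s u" "flat (rotate k segs') = rotate s' v"
    using flat_rotate[of k segs] flat_rotate[of k segs'] hyperbolic(1,2) by (metis rotate_rotate)
  with k have "conjw (length u + (conj_bound n + length v)) u v"
    by (metis conjw_trans[OF conjw_rotate] conjw_trans[OF _ conjw_sym[OF conjw_rotate]])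
  then show ?thesis using assms(2) by (rule_tac conjw_mono) auto
qed

end

section \<open>The conjugator length function\<close>

context snowflake
begin

lemma CL_pair_eq:
  "CL_pair (B_tilde p q) (pres_gen (B_rels p q)) u v
    = (LEAST k. \<exists>w. length w = k \<and> val u + val w = val w + val v)"
  unfolding CL_pair_def word_val_presented_group mult_presented_group pres_class_eq_iff pres_eq_iff_val
  by simp

lemma conj_words_iff:
  "conj_words (B_tilde p q) (pres_gen (B_rels p q)) u v \<longleftrightarrow> (\<exists>w. val u + val w = val w + val v)"
proof -
  have *: "- val w + (val u + val w) = val v \<longleftrightarrow> val u + val w = val w + val v" for w
  proof
    assume "- val w + (val u + val w) = val v"
    then have "val w + val v = val w + (- val w + (val u + val w))" by (simp only:)
    then show "val u + val w = val w + val v" by simp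
  qed simp
  show ?thesis
    unfolding conj_words_def word_val_presented_group carrier_presented_group
    by (simp add: inv_presented_group mult_presented_group pres_class_eq_iff pres_eq_iff_val
        val_winv add.assoc *)
qed

definition CL_set :: "nat \<Rightarrow> nat set" where
  "CL_set n = {CL_pair (B_tilde p q) (pres_gen (B_rels p q)) u v | u v.
     length u + length v \<le> n \<and> conj_words (B_tilde p q) (pres_gen (B_rels p q)) u v}"

lemma CL_eq: "CL_B_tilde p q n = Max (CL_set n)"
  by (simp add: CL_def CL_set_def)

lemma finite_CL_set: "finite (CL_set n)"
proof -
  let ?W = "{w :: B_gen gword. set w \<subseteq> UNIV \<and> length w \<le> n}"
  have "finite ?W" by (rule finite_lists_length_le) simp
  then have "finite ((\<lambda>(u, v). CL_pair (B_tilde p q) (pres_gen (B_rels p q)) u v) ` (?W \<times> ?W))"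
    by blast
  moreover have "CL_set n \<subseteq> (\<lambda>(u, v). CL_pair (B_tilde p q) (pres_gen (B_rels p q)) u v) ` (?W \<times> ?W)"
    by (force simp: CL_set_def)
  ultimately show ?thesis by (rule rev_finite_subset)
qed

lemma CL_set_nonempty: "CL_set n \<noteq> {}"
proof -
  have "conj_words (B_tilde p q) (pres_gen (B_rels p q)) [] []"
    unfolding conj_words_iff by (intro exI[of _ "[]"]) simp
  then show ?thesis unfolding CL_set_def by (auto intro!: exI[of _ "[] :: B_gen gword"])
qed

lemma CL_le: "CL_B_tilde p q n \<le> n + conj_bound n"
  unfolding CL_eq
proof (rule Max.boundedI[OF finite_CL_set CL_set_nonempty])
  fix k assume "k \<in> CL_set n"
  then obtain u v where uv: "length u + length v \<le> n"
      "conj_words (B_tilde p q) (pres_gen (B_rels p q)) u v"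
      "k = CL_pair (B_tilde p q) (pres_gen (B_rels p q)) u v"
    by (auto simp: CL_set_def)
  then obtain g where "val u + val g = val g + val v" by (auto simp: conj_words_iff)
  from conjw_upper[OF this uv(1)] obtain w where w: "length w \<le> n + conj_bound n" "val u + val w = val w + val v"
    by (auto simp: conjw_def)
  have "k \<le> length w" unfolding uv(3) CL_pair_eq by (rule Least_le) (use w in auto)
  then show "k \<le> n + conj_bound n" using w(1) by simp
qed

lemma CL_ge:
  assumes "length u + length v \<le> n" "val u + val g = val g + val v"
    and "\<And>w. val u + val w = val w + val v \<Longrightarrow> m \<le> length w"
  shows "m \<le> CL_B_tilde p q n"
proof -
  let ?P = "\<lambda>k. \<exists>w. length w = k \<and> val u + val w = val w + val v"
  have "?P (LEAST k. ?P k)" by (rule LeastI_ex) (use assms(2) in auto)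
  then obtain w where "length w = (LEAST k. ?P k)" "val u + val w = val w + val v" by blast
  then have "m \<le> CL_pair (B_tilde p q) (pres_gen (B_rels p q)) u v"
    unfolding CL_pair_eq using assms(3)[of w] by (simp only:)
  also have "\<dots> \<le> Max (CL_set n)"
    using assms(1,2) by (intro Max_ge finite_CL_set) (auto simp: CL_set_def conj_words_iff)
  finally show ?thesis by (simp only: CL_eq)
qed

text \<open>
  The exponents \<open>q * height l\<close> of the distorted powers of \<open>a\<close>: \<open>height (Suc l)\<close> is \<open>2 p height l / q\<close>
  rounded up, since \<open>2 p height l\<close> need not be a multiple of \<open>q\<close>.
\<close>
fun height :: "nat \<Rightarrow> nat" where
  "height 0 = 1"
| "height (Suc l) = (2 * p * height l + (q - 1)) div q"

lemma height_Suc: "2 * p * height l \<le> q * height (Suc l)" "q * height (Suc l) < 2 * p * height l + q"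
proof -
  let ?x = "2 * p * height l + (q - 1)"
  have "?x = q * height (Suc l) + ?x mod q" by simp
  moreover have "?x mod q \<le> q - 1" using q_pos mod_less_divisor[of q ?x] by linarith
  ultimately show "2 * p * height l \<le> q * height (Suc l)" "q * height (Suc l) < 2 * p * height l + q"
    using q_pos by linarith+
qed

lemma height_ge: "real (2 ^ l) powr \<alpha> \<le> real (height l)"
proof (induction l)
  case (Suc l)
  have "real (2 ^ Suc l) powr \<alpha> = 2 powr \<alpha> * real (2 ^ l) powr \<alpha>"
    by (simp add: powr_mult)
  also have "\<dots> \<le> (2 * real p / real q) * real (height l)"
    unfolding two_powr_\<alpha> using Suc by (intro mult_left_mono) auto
  also have "\<dots> \<le> real (height (Suc l))"
  proof -
    have "real (2 * p * height l) \<le> real (q * height (Suc l))"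
      using height_Suc(1)[of l] by (simp only: of_nat_le_iff)
    then have "2 * real p * real (height l) \<le> real (height (Suc l)) * real q"
      by (simp only: of_nat_mult of_nat_numeral mult.commute)
    then show ?thesis using q_pos by (simp add: pos_divide_le_eq del: height.simps)
  qed
  finally show ?case .
qed simp

text \<open>
  The identity \<open>(a\<^sup>p b)\<^sup>m (a\<^sup>p b\<^sup>-\<^sup>1)\<^sup>m = a\<^bsup>2pm\<^esup>\<close>; the trailing letters make up for the rounding.
\<close>
fun a_word :: "nat \<Rightarrow> B_gen gword" where
  "a_word 0 = replicate q (Ba, True)"
| "a_word (Suc l) = [(Bs, False)] @ a_word l @ [(Bs, True)] @ [(Bt, False)] @ a_word l @ [(Bt, True)]
     @ replicate (q * height (Suc l) - 2 * p * height l) (Ba, True)"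

lemma t_False: "t (x, False) = - t (x, True)"
  using t_ie[of "(x, True)"] by simp

lemma t_conj_a:
  "- t (SS, True) + (\<mu> (int q * m, 0, 0) + t (SS, True)) = \<mu> (int p * m, m, 0)"
  "- t (ST, True) + (\<mu> (int q * m, 0, 0) + t (ST, True)) = \<mu> (int p * m, - m, 0)"
  using t_conj_edge_elt[of "(SS, True)" m 0] t_conj_edge_elt[of "(ST, True)" m 0] by (simp_all add: edge_elt_def mult.commute)

lemma val_a_word: "val (a_word l) = \<mu> (int q * int (height l), 0, 0)"
proof (induction l)
  case 0
  show ?case by (simp add: val_replicate[of _ 1 0 0])
next
  case (Suc l)
  let ?m = "int (height l)" and ?r = "int (q * height (Suc l) - 2 * p * height l)"
  have "val (a_word (Suc l)) = (- t (SS, True) + (\<mu> (int q * ?m, 0, 0) + t (SS, True)))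
      + (- t (ST, True) + (\<mu> (int q * ?m, 0, 0) + t (ST, True))) + \<mu> (?r, 0, 0)"
    by (simp add: Suc lval_simps t_False val_replicate[of _ 1 0 0] add.assoc del: height.simps)
  also have "\<dots> = \<mu> (int p * ?m + int p * ?m + ?r, 0, 0)"
    unfolding t_conj_a by (simp flip: \<mu>_add)
  also have "int p * ?m + int p * ?m + ?r = int q * int (height (Suc l))"
    using height_Suc(1)[of l] by (simp add: of_nat_diff algebra_simps del: height.simps)
  finally show ?case .
qed

lemma length_a_word: "length (a_word l) + (q + 4) \<le> 2 ^ l * (2 * q + 4)"
proof (induction l)
  case (Suc l)
  have "length (a_word (Suc l)) \<le> 2 * length (a_word l) + 4 + q"
    using height_Suc(2)[of l] by (simp del: height.simps) 
  then show ?case using Suc by simp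
qed simp

text \<open>
  The identity \<open>(a\<^sup>p b)\<^sup>m (a\<^sup>p b\<^sup>-\<^sup>1)\<^bsup>-m\<^esup> = b\<^bsup>2m\<^esup>\<close>.
\<close>
definition b_word :: "nat \<Rightarrow> B_gen gword" where
  "b_word l = [(Bs, False)] @ a_word l @ [(Bs, True)] @ [(Bt, False)] @ winv (a_word l) @ [(Bt, True)]"

lemma val_b_word: "val (b_word l) = \<mu> (0, 2 * int (height l), 0)"
proof -
  let ?m = "int (height l)"
  have "val (winv (a_word l)) = \<mu> (int q * (- ?m), 0, 0)"
    by (simp add: val_winv val_a_word flip: \<mu>_minus)
  then have "val (b_word l) = (- t (SS, True) + (\<mu> (int q * ?m, 0, 0) + t (SS, True)))
      + (- t (ST, True) + (\<mu> (int q * (- ?m), 0, 0) + t (ST, True)))"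
    by (simp add: b_word_def lval_simps t_False val_a_word add.assoc)
  also have "\<dots> = \<mu> (0, 2 * ?m, 0)"
    unfolding t_conj_a by (simp flip: \<mu>_add)
  finally show ?thesis .
qed

definition z_word :: "nat \<Rightarrow> B_gen gword" where
  "z_word l = wcomm (b_word l) (power_word Btheta (2 ^ l))"

lemma val_z_word: "val (z_word l) = \<mu> (0, 0, 2 * int (height l) * 2 ^ l)"
proof -
  let ?j = "2 * int (height l)" and ?T = "val (power_word Btheta (2 ^ l))"
  have "val (z_word l) = - \<mu> (0, ?j, 0) + (- ?T + (\<mu> (0, ?j, 0) + ?T))"
    by (simp add: z_word_def wcomm_def val_winv val_b_word)
  also have "\<dots> = - \<mu> (0, ?j, 0) + \<mu> (0, ?j, 0 + ?j * 2 ^ l)"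
    unfolding \<mu>_val_theta by simp
  finally show ?thesis by (simp flip: \<mu>_add \<mu>_minus)
qed

lemma length_z_word: "length (z_word l) \<le> 2 ^ l * (8 * q + 18)"
proof -
  have "length (z_word l) = 2 * (2 * length (a_word l) + 4) + 2 * 2 ^ l"
    by (simp add: z_word_def wcomm_def b_word_def winv_def nat_power_eq)
  also have "\<dots> \<le> 4 * (length (a_word l) + (q + 4)) + 2 * 2 ^ l" by simp
  also have "\<dots> \<le> 4 * (2 ^ l * (2 * q + 4)) + 2 * 2 ^ l"
    using length_a_word[of l] by (intro add_mono mult_left_mono) auto
  finally show ?thesis by (simp add: algebra_simps)
qed

text \<open>
  The pair is \<open>b\<close> and \<open>b z\<^sup>N\<close>. In a conjugator every stable letter must preserve the \<open>b\<close> axis and shears by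
  at most one, so at least \<open>N\<close> of them are needed.
\<close>
lemma CL_ge_height:
  assumes "2 ^ l * (8 * q + 20) \<le> n"
  shows "2 * height l * 2 ^ l \<le> CL_B_tilde p q n"
proof (rule CL_ge)
  let ?u = "[(Bb, True)]" and ?k = "2 * int (height l) * 2 ^ l"
  let ?v = "?u @ z_word l"
  have u: "val ?u = \<mu> (0, 1, 0)" by (simp add: lval_simps)
  have v: "val ?v = \<mu> (0, 1, ?k)" by (simp add: lval_simps val_z_word flip: \<mu>_add)
  have "length ?u + length ?v = 2 + length (z_word l)" by simp
  also have "\<dots> \<le> 2 ^ l * 2 + 2 ^ l * (8 * q + 18)"
    using length_z_word[of l] by (intro add_mono) auto
  also have "\<dots> = 2 ^ l * (8 * q + 20)" by (simp add: algebra_simps)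
  finally show "length ?u + length ?v \<le> n" using assms by (rule order_trans)
  show "val ?u + val (power_word Btheta ?k) = val (power_word Btheta ?k) + val ?v"
    unfolding u v \<mu>_val_theta by simp
  fix w assume w: "val ?u + val w = val w + val ?v"
  have pins: "pinches ?u (0, 1, 0)" "pinches ?v (0, 1, ?k)" unfolding pinches_iff by (rule u, rule v)
  then have "cyc_form ?v" by (auto simp: cyc_form_def)
  from elliptic_conj_words[OF pins(1) this w] obtain g' es
    where g': "pinches ?v g'" "chain (0, 1, 0) es g'" "length es \<le> length w" by blast
  then have "g' = (0, 1, ?k)" using v val_pinches \<mu>_inj by metis
  with chain_related[OF g'(2)] have "conj_related (length es) (0, 1, 0) (0, 1, ?k)" by simp
  then have "nat ?k \<le> length es"
    unfolding conj_related_def by (elim disjE exE conjE) (auto simp: edge_elt_def)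
  moreover have "nat ?k = 2 * height l * 2 ^ l" by (simp add: nat_mult_distrib nat_power_eq)
  ultimately show "2 * height l * 2 ^ l \<le> length w" using g'(3) by simp
qed

lemma CL_upper: "(\<lambda>n. real (CL_B_tilde p q n)) \<lesssim> (\<lambda>n. real n powr (\<alpha> + 1))"
proof -
  define C where "C = nat \<lceil>conj_const\<rceil> + 2"
  have "real (CL_B_tilde p q n) \<le> real C * real (C * n + n) powr (\<alpha> + 1) + real C * real n + real C" for n
  proof -
    have KC: "conj_const \<le> real C" unfolding C_def using conj_const_bounds(3) by linarith
    have "real (CL_B_tilde p q n) \<le> real n + real (conj_bound n)" using CL_le[of n] by linarith
    also have "real (conj_bound n) \<le> 2 + conj_const * real n powr (\<alpha> + 1)"
      unfolding conj_bound_def using conj_const_bounds(3) by (simp add: of_nat_floor)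
    also have "conj_const * real n powr (\<alpha> + 1) \<le> real C * real (C * n + n) powr (\<alpha> + 1)"
      using KC conj_const_bounds(3) \<alpha>_ge_1 by (intro mult_mono powr_mono2) auto
    also have "real n + (2 + real C * real (C * n + n) powr (\<alpha> + 1))
        \<le> real C * real (C * n + n) powr (\<alpha> + 1) + real C * real n + real C"
    proof -
      have "1 * real n \<le> real C * real n" by (intro mult_right_mono) (auto simp: C_def)
      moreover have "2 \<le> real C" by (simp add: C_def)
      ultimately show ?thesis by linarith
    qed
    finally show ?thesis by simp
  qed
  moreover have "C > 0" by (simp add: C_def)
  ultimately show ?thesis unfolding growth_le_def by blast
qed

lemma CL_lower: "(\<lambda>n. real n powr (\<alpha> + 1)) \<lesssim> (\<lambda>n. real (CL_B_tilde p q n))"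
proof -
  \<comment> \<open>The first two terms cover the length of the pair, the last one \<open>2\<^bsup>\<alpha>+1\<^esup> = 4p/q\<close>.\<close>
  define C where "C = 8 * q + 20 + 4 * p"
  have "real n powr (\<alpha> + 1) \<le> real C * real (CL_B_tilde p q (C * n + n)) + real C * real n + real C" for n
  proof (cases "n = 0")
    case False
    then obtain l where l: "2 ^ l \<le> n" "n < 2 ^ (l + 1)"
      using ex_power_ivl1[of 2 n] by auto
    have "2 ^ l * (8 * q + 20) \<le> n * C" using l(1) by (intro mult_mono) (auto simp: C_def)
    then have CL: "2 * height l * 2 ^ l \<le> CL_B_tilde p q (C * n + n)"
      by (intro CL_ge_height) (simp add: mult.commute)
    let ?N = "real (2 ^ l)"
    have "real n < real (2 ^ (l + 1))" using l(2) by (simp only: of_nat_less_iff)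
    then have "real n \<le> 2 * ?N" by simp
    then have "real n powr (\<alpha> + 1) \<le> (2 * ?N) powr (\<alpha> + 1)"
      using \<alpha>_ge_1 by (intro powr_mono2) auto
    also have "\<dots> = (2 powr \<alpha> * 2) * (?N powr \<alpha> * ?N)" by (simp add: powr_mult powr_add)
    also have "\<dots> \<le> (2 powr \<alpha> * 2) * (real (height l) * ?N)"
      using height_ge[of l] by (intro mult_left_mono mult_right_mono) auto
    also have "\<dots> = (2 * real p / real q) * real (2 * height l * 2 ^ l)"
      by (simp add: two_powr_\<alpha>)
    also have "\<dots> \<le> real C * real (CL_B_tilde p q (C * n + n))"
    proof (rule mult_mono)
      have "2 * real p / real q \<le> 2 * real p / 1"
        using q_pos by (intro divide_left_mono) auto
      then show "2 * real p / real q \<le> real C" by (simp add: C_def)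
      show "real (2 * height l * 2 ^ l) \<le> real (CL_B_tilde p q (C * n + n))"
        using CL by (simp only: of_nat_le_iff)
    qed auto
    finally show ?thesis by (simp add: add_increasing2)
  qed simp
  moreover have "C > 0" by (simp add: C_def)
  ultimately show ?thesis unfolding growth_le_def by blast
qed

end

theorem theorem1p6:
  fixes p q :: nat and \<alpha> :: real
  assumes "q > 0" and "p > q"
    and "\<alpha> = log 2 (2 * real p / real q)"
  shows "(\<lambda>n. real (CL_B_tilde p q n)) \<simeq> (\<lambda>n. real n powr (\<alpha> + 1))"
proof -
  interpret snowflake p q by unfold_locales (use assms in auto)
  have "\<alpha> = snowflake.\<alpha> p q" using assms(3) by (simp add: \<alpha>_def)
  then show ?thesis using CL_upper CL_lower by (simp add: growth_equiv_def)
qed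

end
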